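(* Let $n\ge 1$. There exists a unique function $\iota : \Lambda(n)^3 \to \{0,1,\ldots,n\}$ (called the Duistermaat index) that satisfies the following three properties. (1) (Normalization) For any $n\times n$ Hermitian matrix $A$, $$\iota(\mathcal{G}_0, \mathcal{G}_A, \mathcal{G}_\infty) = n_-(A).$$ (2) (Symplectic invariance) For any symplectic transformation $\mathsf{S}$ on $\mathbb{C}^n\oplus\mathbb{C}^n$ and any $\mathcal{L}_1,\mathcal{L}_2,\mathcal{L}_3\in\Lambda(n)$, $$\iota(\mathsf{S}\mathcal{L}_1, \mathsf{S}\mathcal{L}_2, \mathsf{S}\mathcal{L}_3) = \iota(\mathcal{L}_1, \mathcal{L}_2, \mathcal{L}_3).$$ (3) (Cocycle property) For any $\mathcal{L}_1,\mathcal{L}_2,\mathcal{L}_3,\mathcal{L}_4\in\Lambda(n)$, $$\iota(\mathcal{L}_1,\mathcal{L}_2,\mathcal{L}_3) - \iota(\mathcal{L}_1,\mathcal{L}_2,\mathcal{L}_4) + \iota(\mathcal{L}_1,\mathcal{L}_3,\mathcal{L}_4) - \iota(\mathcal{L}_2,\mathcal{L}_3,\mathcal{L}_4) = 0.$$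
   Context: $\mathbb{C}^n\oplus\mathbb{C}^n$ is equipped with the canonical (sesquilinear) Hermitian symplectic form $\omega((x_1,x_2),(y_1,y_2)) := \langle x_1,y_2\rangle_{\mathbb{C}^n} - \langle x_2,y_1\rangle_{\mathbb{C}^n}$. A subspace $\mathcal{L}$ is Lagrangian (a "Lagrangian plane") if it equals its symplectic complement $\mathcal{L}^\omega := \{v : \omega(u,v)=0 \text{ for all } u\in\mathcal{L}\}$; such subspaces have dimension $n$. $\Lambda(n)$ denotes the set of Lagrangian planes in $(\mathbb{C}^n\oplus\mathbb{C}^n,\omega)$. A symplectic transformation is a complex-linear bijection $\mathsf{S}$ of $\mathbb{C}^n\oplus\mathbb{C}^n$ with $\omega(\mathsf{S}u,\mathsf{S}v)=\omega(u,v)$ for all $u,v$. For an $n\times n$ Hermitian matrix $M$, $\mathcal{G}_M := \{(x,Mx): x\in\mathbb{C}^n\}$ is its graph; in particular $\mathcal{G}_0=\mathbb{C}^n\oplus 0$. Also $\mathcal{G}_\infty := 0\oplus\mathbb{C}^n$. $n_-(A)$ denotes the number of negative eigenvalues of $A$, counted with multiplicity (Morse index). *)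

theory Defs
  imports "HOL-Analysis.Analysis"
begin

text \<open>
  The space $\mathbb{C}^n \oplus \mathbb{C}^n$ is the product type \<open>(complex^'n) \<times> (complex^'n)\<close>
  with $n$ = \<open>CARD('n)\<close>. The library only registers its real structure; the interpretation
  below provides the complex one, \<open>cplane.scale c (x, y) = (c *s x, c *s y)\<close>.
\<close>

interpretation cplane: finite_dimensional_vector_space_prod
  "(*s) :: complex \<Rightarrow> complex^'n \<Rightarrow> complex^'n"
  "(*s) :: complex \<Rightarrow> complex^'n \<Rightarrow> complex^'n"
  cart_basis cart_basis ..

type_synonym 'n cplane = "(complex^'n) \<times> (complex^'n)"

text \<open>
  The inner product is conjugate-linear in the first argument. The other convention replaces
  \<open>symp_form\<close> by its complex conjugate, which changes neither the Lagrangian planes nor the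
  symplectic transformations.
\<close>

definition cinner :: "complex^'n \<Rightarrow> complex^'n \<Rightarrow> complex" where
  "cinner x y = (\<Sum>i\<in>UNIV. cnj (x $ i) * y $ i)"

definition symp_form :: "'n::finite cplane \<Rightarrow> 'n cplane \<Rightarrow> complex" where
  "symp_form u v = cinner (fst u) (snd v) - cinner (snd u) (fst v)"

definition symp_complement :: "'n::finite cplane set \<Rightarrow> 'n cplane set" where
  "symp_complement L = {v. \<forall>u\<in>L. symp_form u v = 0}"

definition Lagrangian :: "'n::finite cplane set set" where
  "Lagrangian = {L. cplane.p.subspace L \<and> symp_complement L = L}"

definition symplectic :: "('n::finite cplane \<Rightarrow> 'n cplane) \<Rightarrow> bool" where
  "symplectic S \<longleftrightarrow>
     Vector_Spaces.linear cplane.scale cplane.scale S \<and> bij S \<and>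
     (\<forall>u v. symp_form (S u) (S v) = symp_form u v)"

definition hermitian :: "complex^'n^'n \<Rightarrow> bool" where
  "hermitian A \<longleftrightarrow> (\<forall>i j. A $ j $ i = cnj (A $ i $ j))"

definition graph_plane :: "complex^'n^'n \<Rightarrow> 'n::finite cplane set" where
  "graph_plane M = {(x, M *v x) | x. True}"

definition infinity_plane :: "'n::finite cplane set" where
  "infinity_plane = {0} \<times> UNIV"

definition eigenspace :: "complex^'n^'n \<Rightarrow> complex \<Rightarrow> (complex^'n) set" where
  "eigenspace A c = {x. A *v x = c *s x}"

definition eigenvalue :: "complex^'n^'n \<Rightarrow> complex \<Rightarrow> bool" where
  "eigenvalue A c \<longleftrightarrow> (\<exists>x. x \<noteq> 0 \<and> A *v x = c *s x)"

text \<open>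
  The multiplicity is the complex dimension of the eigenspace, which for a Hermitian matrix is
  also the algebraic one. The index set of the sum is finite, as is the spectrum of any matrix.
\<close>

definition morse_index :: "complex^'n^'n \<Rightarrow> nat" where
  "morse_index A =
     (\<Sum>r | r < 0 \<and> eigenvalue A (complex_of_real r). vec.dim (eigenspace A (complex_of_real r)))"

end

theory Submission
  imports Defs
begin

text \<open>
  The index is \<open>n\<^sub>-(q) + dim (L1 \<inter> L3) - dim (L1 \<inter> L2 \<inter> L3)\<close>, where \<open>q(x, y) = \<omega>(x, y)\<close> on the
  space of pairs \<open>(x, y) \<in> L1 \<times> L3\<close> with \<open>x + y \<in> L2\<close>; this is visibly a symplectic invariant.
  For a Hermitian form and a subspace \<open>D\<close> with orthogonal complement \<open>E\<close>,
  \<open>n\<^sub>- + dim (D \<inter> rad) = n\<^sub>-(D) + n\<^sub>-(E) + dim (D \<inter> E)\<close>. Applied to the form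
  \<open>(A2 - A1) \<oplus> (A3 - A2)\<close> and the antidiagonal, this identifies the index of the graphs of
  \<open>A1, A2, A3\<close> with \<open>n\<^sub>-(A2 - A1) + n\<^sub>-(A3 - A2) - n\<^sub>-(A3 - A1)\<close>, a coboundary that lies in
  \<open>{0..n}\<close>. Finitely many Lagrangian planes can always be moved to graphs simultaneously: a plane
  meets the graph of the scalar \<open>t\<close> nontrivially only for finitely many real \<open>t\<close>, because the
  intersection vectors for different \<open>t\<close> are orthogonal. The same reduction, together with the
  cocycle property for the fourth plane \<open>infinity_plane\<close> and a shear, forces uniqueness.
\<close>

section \<open>The negative index of a quadratic form\<close>

locale complex_space = finite_dimensional_vector_space scale Basis
  for scale :: "complex \<Rightarrow> 'b::ab_group_add \<Rightarrow> 'b" and Basis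
begin

definition negative_on :: "('b \<Rightarrow> real) \<Rightarrow> 'b set \<Rightarrow> bool" where
  "negative_on q N \<longleftrightarrow> subspace N \<and> (\<forall>x\<in>N. x \<noteq> 0 \<longrightarrow> q x < 0)"

text \<open>Only values of \<open>q\<close> enter, not a sesquilinear form, so the index can be
  carried along linear maps between different spaces. For a subspace \<open>V\<close> the set of
  dimensions is finite and contains 0, so the maximum is attained.\<close>

definition neg_index :: "('b \<Rightarrow> real) \<Rightarrow> 'b set \<Rightarrow> nat" where
  "neg_index q V = Max (dim ` {N. negative_on q N \<and> N \<subseteq> V})"

lemma finite_dims: "finite (dim ` \<N>)"
  by (rule finite_subset[of _ "{..dimension}"]) (use dim_subset_UNIV in auto)

lemma dim_le_neg_index:
  assumes "negative_on q N" "N \<subseteq> V"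
  shows "dim N \<le> neg_index q V"
  unfolding neg_index_def by (rule Max_ge) (use assms finite_dims in auto)

lemma neg_index_attained:
  assumes "subspace V"
  obtains N where "negative_on q N" "N \<subseteq> V" "dim N = neg_index q V"
proof -
  have "{0} \<in> {N. negative_on q N \<and> N \<subseteq> V}"
    using subspace_0[OF assms] by (simp add: negative_on_def)
  then have "neg_index q V \<in> dim ` {N. negative_on q N \<and> N \<subseteq> V}"
    unfolding neg_index_def by (intro Max_in finite_dims) blast
  with that show thesis by auto
qed

lemma dim_direct_sum:
  assumes "subspace S" "subspace T" "S \<inter> T \<subseteq> {0}"
  shows "dim {x + y |x y. x \<in> S \<and> y \<in> T} = dim S + dim T"
proof -
  have "dim (S \<inter> T) = 0" using assms(3) by (simp only: dim_eq_0)
  then show ?thesis using dim_sums_Int[OF assms(1,2)] by linarith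
qed

lemma dim_add_le_dim_Int:
  assumes "subspace S" "subspace T" "S \<subseteq> V" "T \<subseteq> V" "subspace V"
  shows "dim S + dim T \<le> dim V + dim (S \<inter> T)"
proof -
  have "dim {x + y |x y. x \<in> S \<and> y \<in> T} \<le> dim V"
    by (rule dim_subset) (use assms subspace_add in blast)
  then show ?thesis using dim_sums_Int[OF assms(1,2)] by linarith
qed

lemma dim_add_le_of_Int_trivial:
  assumes "subspace S" "subspace T" "S \<inter> T \<subseteq> {0}" "S \<subseteq> V" "T \<subseteq> V" "subspace V"
  shows "dim S + dim T \<le> dim V"
proof -
  have "dim (S \<inter> T) = 0" using assms(3) by (simp only: dim_eq_0)
  then show ?thesis using dim_add_le_dim_Int[OF assms(1,2,4,5,6)] by linarith
qed

lemma negative_Int_nonneg: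
  assumes "negative_on q N" and "\<And>x. x \<in> P \<Longrightarrow> 0 \<le> q x"
  shows "N \<inter> P \<subseteq> {0}"
proof
  fix x assume "x \<in> N \<inter> P"
  then show "x \<in> {0}" using assms(1) assms(2)[of x] by (fastforce simp: negative_on_def)
qed

text \<open>A negative and a nonnegative subspace meet only in 0, so their dimensions add up to at
  most that of \<open>V\<close>.\<close>

lemma neg_index_add_dim_le:
  assumes "subspace V" "subspace P" "P \<subseteq> V" and nonneg: "\<And>x. x \<in> P \<Longrightarrow> 0 \<le> q x"
  shows "neg_index q V + dim P \<le> dim V"
proof -
  obtain N where N: "negative_on q N" "N \<subseteq> V" "dim N = neg_index q V"
    by (rule neg_index_attained[OF assms(1)])
  have "N \<inter> P \<subseteq> {0}"
    using N(1) nonneg by (rule negative_Int_nonneg)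
  then show ?thesis
    using dim_add_le_of_Int_trivial[of N P V] N assms by (auto simp: negative_on_def)
qed

text \<open>A certificate for the value of the index: \<open>N\<close> bounds it from below, and a
  nonnegative \<open>P\<close> of complementary dimension bounds it from above.\<close>

lemma neg_index_unique:
  assumes "subspace V" "negative_on q N" "N \<subseteq> V" "subspace P" "P \<subseteq> V"
    and "\<And>x. x \<in> P \<Longrightarrow> 0 \<le> q x" and "dim V \<le> dim N + dim P"
  shows "neg_index q V = dim N"
  using neg_index_add_dim_le[of V P q] dim_le_neg_index[of q N V] assms by force

end

locale complex_space_pair = vs1: complex_space s1 B1 + vs2: complex_space s2 B2
  for s1 :: "complex \<Rightarrow> 'b::ab_group_add \<Rightarrow> 'b" and B1
    and s2 :: "complex \<Rightarrow> 'c::ab_group_add \<Rightarrow> 'c" and B2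
begin

sublocale finite_dimensional_vector_space_pair s1 B1 s2 B2 ..

text \<open>Images and preimages under \<open>f\<close> match the negative subspaces of
  \<open>V\<close> with those of its image. Injectivity on \<open>V\<close> keeps nonzero vectors
  nonzero and preserves dimensions.\<close>

lemma neg_index_image:
  assumes f: "Vector_Spaces.linear s1 s2 f" and inj: "inj_on f V" and V: "vs1.subspace V"
    and q: "\<And>x. x \<in> V \<Longrightarrow> q2 (f x) = q1 x"
  shows "vs2.neg_index q2 (f ` V) = vs1.neg_index q1 V"
proof -
  interpret f: Vector_Spaces.linear s1 s2 f by (fact f)
  have dim: "vs2.dim (f ` N) = vs1.dim N" if "vs1.subspace N" "N \<subseteq> V" for N
    using that inj by (intro dim_image_eq f) (metis inj_on_subset vs1.span_eq_iff)
  show ?thesis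
  proof (rule antisym)
    obtain M where M: "vs2.negative_on q2 M" "M \<subseteq> f ` V" "vs2.dim M = vs2.neg_index q2 (f ` V)"
      by (rule vs2.neg_index_attained[OF f.subspace_image[OF V]])
    define N where "N = V \<inter> f -` M"
    have "vs1.subspace N"
      unfolding N_def using M(1) by (intro vs1.subspace_inter V f.subspace_vimage)
        (simp add: vs2.negative_on_def)
    moreover have "q1 x < 0" if "x \<in> N" "x \<noteq> 0" for x
    proof -
      have "f x \<noteq> 0"
        using that inj vs1.subspace_0[OF V] inj_onD[of f V x 0] by (auto simp: N_def)
      then show ?thesis using that M(1) q[of x] by (auto simp: N_def vs2.negative_on_def)
    qed
    ultimately have "vs1.negative_on q1 N" by (simp add: vs1.negative_on_def)
    moreover have "f ` N = M" using M(2) by (auto simp: N_def)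
    ultimately show "vs2.neg_index q2 (f ` V) \<le> vs1.neg_index q1 V"
      using M(3) dim[of N] vs1.dim_le_neg_index[of q1 N V] \<open>vs1.subspace N\<close> by (auto simp: N_def)
  next
    obtain N where N: "vs1.negative_on q1 N" "N \<subseteq> V" "vs1.dim N = vs1.neg_index q1 V"
      by (rule vs1.neg_index_attained[OF V])
    have "vs2.negative_on q2 (f ` N)"
      using N(1,2) q f.subspace_image f.zero
      by (auto simp: vs1.negative_on_def vs2.negative_on_def subset_iff)
    then show "vs1.neg_index q1 V \<le> vs2.neg_index q2 (f ` V)"
      using N dim[of N] vs2.dim_le_neg_index[of q2 "f ` N" "f ` V"]
      by (auto simp: vs1.negative_on_def)
  qed
qed

end

section \<open>Inertia of Hermitian forms\<close>

locale hermitian_form = complex_space scale Basis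
  for scale :: "complex \<Rightarrow> 'b::ab_group_add \<Rightarrow> 'b" and Basis +
  fixes h :: "'b \<Rightarrow> 'b \<Rightarrow> complex"
  assumes add_right: "h x (y + z) = h x y + h x z"
    and scale_right: "h x (scale c y) = c * h x y"
    and conj_sym: "h y x = cnj (h x y)"
begin

abbreviation quad :: "'b \<Rightarrow> real" where
  "quad x \<equiv> Re (h x x)"

text \<open>The form may be degenerate; \<open>perp UNIV\<close> is its radical.\<close>

definition perp :: "'b set \<Rightarrow> 'b set" where
  "perp D = {x. \<forall>y\<in>D. h y x = 0}"

lemma add_left: "h (x + y) z = h x z + h y z"
  by (metis add_right conj_sym complex_cnj_add)

lemma scale_left: "h (scale c x) y = cnj c * h x y"
  by (metis scale_right conj_sym complex_cnj_mult)

lemma zero_right [simp]: "h x 0 = 0"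
  using scale_right[of x 0 0] by simp

lemma zero_left [simp]: "h 0 x = 0"
  using scale_left[of 0 0 x] by simp

lemma subspace_perp: "subspace (perp D)"
  by (rule subspaceI) (auto simp: perp_def add_right scale_right)

lemma perpD: "x \<in> perp D \<Longrightarrow> y \<in> D \<Longrightarrow> h y x = 0" "x \<in> perp D \<Longrightarrow> y \<in> D \<Longrightarrow> h x y = 0"
  using conj_sym[of x y] by (auto simp: perp_def)

lemma quad_add_orthogonal: "h x y = 0 \<Longrightarrow> quad (x + y) = quad x + quad y"
  using conj_sym[of x y] by (simp add: add_left add_right)

lemma perp_span: "perp (span D) = perp D"
proof
  show "perp (span D) \<subseteq> perp D" using span_superset by (auto simp: perp_def)
  show "perp D \<subseteq> perp (span D)"
  proof
    fix x assume x: "x \<in> perp D"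
    have "h y x = 0" if "y \<in> span D" for y
      using that
      by (induction rule: span_induct_alt) (use x in \<open>auto simp: add_left scale_left perp_def\<close>)
    then show "x \<in> perp (span D)" by (simp add: perp_def)
  qed
qed

text \<open>Each condition \<open>h c x = 0\<close> is linear in \<open>x\<close> and lowers the
  dimension by at most one.\<close>

lemma dim_le_dim_Int_perp_card:
  assumes "finite C" "subspace V"
  shows "dim V \<le> dim (V \<inter> perp C) + card C"
  using assms(1)
proof (induction C rule: finite_induct)
  case empty
  then show ?case by (simp add: perp_def)
next
  case (insert c C)
  let ?U = "V \<inter> perp C" and ?U' = "V \<inter> perp (insert c C)"
  have "dim ?U \<le> Suc (dim ?U')"
  proof (cases "\<exists>v\<in>?U. h c v \<noteq> 0")
    case False
    then have "?U \<subseteq> ?U'" by (auto simp: perp_def)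
    then show ?thesis using dim_subset le_SucI by blast
  next
    case True
    then obtain v where v: "v \<in> ?U" "h c v \<noteq> 0" by blast
    have sub: "subspace ?U" by (intro subspace_inter assms subspace_perp)
    have "x \<in> span (insert v ?U')" if x: "x \<in> ?U" for x
    proof -
      \<comment> \<open>With this coefficient \<open>x - scale k v\<close> is orthogonal to
        \<open>c\<close>, so \<open>v\<close> together with \<open>?U'\<close> spans
        \<open>?U\<close>.\<close>
      define k where "k = h c x / h c v"
      have "h c (x - scale k v) = h c (x + scale (- k) v)" by simp
      also have "\<dots> = 0" unfolding add_right scale_right using v by (simp add: k_def)
      finally have "h c (x - scale k v) = 0" .
      moreover have "x - scale k v \<in> ?U"
        using sub x v by (intro subspace_diff subspace_scale)
      ultimately have "x - scale k v \<in> ?U'" by (auto simp: perp_def)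
      then show ?thesis using span_breakdown_eq span_base by blast
    qed
    then have "dim ?U \<le> dim (insert v ?U')"
      by (metis dim_span dim_subset subsetI)
    then show ?thesis by (simp add: dim_insert split: if_splits)
  qed
  then show ?case using insert by simp
qed

text \<open>Orthogonality to \<open>D\<close> amounts to \<open>dim D\<close> linear conditions, and
  those coming from \<open>R\<close> hold on \<open>V\<close> automatically. Taking
  \<open>R = {0}\<close> gives the usual estimate; a nonzero \<open>R\<close> inside the radical
  sharpens it.\<close>

lemma dim_perp_ge:
  assumes "subspace V" "subspace D" "subspace R" "R \<subseteq> D" and R: "V \<subseteq> perp R"
  shows "dim V + dim R \<le> dim (V \<inter> perp D) + dim D"
proof -
  obtain B where B: "B \<subseteq> R" "independent B" "R \<subseteq> span B" "card B = dim R"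
    by (rule basis_exists)
  \<comment> \<open>A basis \<open>B\<close> of \<open>R\<close> is extended to a basis
    \<open>C\<close> of \<open>D\<close>; only the vectors of \<open>C - B\<close> impose conditions
    on \<open>V\<close>.\<close>
  obtain C where C: "B \<subseteq> C" "C \<subseteq> D" "independent C" "D \<subseteq> span C"
    by (rule maximal_independent_subset_extend[of B D]) (use B \<open>R \<subseteq> D\<close> in auto)
  have "finite C" using C(3) finiteI_independent by blast
  have "card C = dim D" using C basis_card_eq_dim by blast
  have "perp C = perp D"
    using perp_span[of C] span_subspace[OF C(2,4) assms(2)] by simp
  moreover have "V \<inter> perp (C - B) \<subseteq> perp C"
    using R B(1) by (auto simp: perp_def subset_iff)
  ultimately have "dim (V \<inter> perp (C - B)) \<le> dim (V \<inter> perp D)"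
    by (intro dim_subset) auto
  moreover have "card (C - B) + card B = card C"
    using C(1) \<open>finite C\<close> by (metis card_Diff_subset card_mono finite_subset le_add_diff_inverse2)
  moreover have "dim V \<le> dim (V \<inter> perp (C - B)) + card (C - B)"
    by (rule dim_le_dim_Int_perp_card) (use \<open>finite C\<close> assms(1) in auto)
  ultimately show ?thesis using B(4) \<open>card C = dim D\<close> by linarith
qed

text \<open>The form vanishes at \<open>x\<close>. If \<open>h x y\<close> were nonzero, a small
  step from \<open>x\<close> along a suitable multiple of \<open>y\<close> would make it negative to
  first order.\<close>

lemma isotropic_in_nonneg_subspace:
  assumes "subspace P" and nonneg: "\<And>x. x \<in> P \<Longrightarrow> 0 \<le> quad x"
    and x: "x \<in> P" "quad x = 0" and y: "y \<in> P"
  shows "h x y = 0"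
proof (rule ccontr)
  assume "h x y \<noteq> 0"
  \<comment> \<open>Small enough that \<open>t * quad y < 1\<close>, so the second-order term cannot
    outweigh the first-order one.\<close>
  define t where "t = 1 / (1 + quad y)"
  have t: "t > 0" "t * quad y < 1"
    using nonneg[OF y] by (auto simp: t_def divide_simps)
  \<comment> \<open>The conjugate makes the cross term \<open>c * h x y\<close> a negative real
    number.\<close>
  define c where "c = - (of_real t * cnj (h x y))"
  have "quad (x + scale c y) = quad x + 2 * Re (c * h x y) + Re (c * cnj c * h y y)"
    using conj_sym[of x y]
    by (simp add: add_left add_right scale_left scale_right algebra_simps)
  also have "c * h x y = - of_real (t * (cmod (h x y))\<^sup>2)"
    by (simp add: c_def complex_norm_square[symmetric] mult_ac)
  also have "c * cnj c = of_real (t\<^sup>2 * (cmod (h x y))\<^sup>2)"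
    by (simp add: c_def complex_norm_square[symmetric] power2_eq_square[of t] mult_ac)
  also have "quad x + 2 * Re (- complex_of_real (t * (cmod (h x y))\<^sup>2)) +
      Re (of_real (t\<^sup>2 * (cmod (h x y))\<^sup>2) * h y y) = (t * (cmod (h x y))\<^sup>2) * (t * quad y - 2)"
    using x(2) by (simp add: algebra_simps power2_eq_square)
  also have "\<dots> < 0"
    using t \<open>h x y \<noteq> 0\<close> by (intro mult_pos_neg) auto
  finally show False
    using nonneg[of "x + scale c y"] assms(1) x y by (simp add: subspace_add subspace_scale)
qed

text \<open>Take \<open>N\<close> negative of maximal dimension. A vector of \<open>V\<close>
  orthogonal to \<open>N\<close> with a negative value could be adjoined to \<open>N\<close>, so the
  form is nonnegative on the orthogonal complement. No nondegeneracy is involved: isotropic vectors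
  end up in \<open>P\<close>.\<close>

lemma neg_index_decomposition:
  assumes "subspace V"
  obtains N P where "negative_on quad N" "N \<subseteq> V" "dim N = neg_index quad V"
    "subspace P" "P = V \<inter> perp N" "\<And>x. x \<in> P \<Longrightarrow> 0 \<le> quad x" "dim N + dim P = dim V"
proof -
  obtain N where N: "negative_on quad N" "N \<subseteq> V" "dim N = neg_index quad V"
    by (rule neg_index_attained[OF assms])
  then have subN: "subspace N" by (simp add: negative_on_def)
  define P where "P = V \<inter> perp N"
  have subP: "subspace P" unfolding P_def by (intro subspace_inter assms subspace_perp)
  have nonneg: "0 \<le> quad x" if x: "x \<in> P" for x
  proof (rule ccontr)
    assume neg: "\<not> 0 \<le> quad x"
    have xN: "x \<in> perp N" using x by (simp add: P_def)
    have "quad z < 0" if z: "z \<in> span (insert x N)" "z \<noteq> 0" for z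
    proof -
      obtain k where k: "z - scale k x \<in> N"
        using z span_breakdown_eq subN span_eq_iff by metis
      define w where "w = z - scale k x"
      have z_eq: "z = w + scale k x" by (simp add: w_def)
      have "h w (scale k x) = 0" using perpD(1)[OF xN] k by (simp add: w_def scale_right)
      then have "quad z = quad w + quad (scale k x)"
        unfolding z_eq by (rule quad_add_orthogonal)
      also have "quad (scale k x) = (cmod k)\<^sup>2 * quad x"
      proof -
        have "h (scale k x) (scale k x) = of_real ((cmod k)\<^sup>2) * h x x"
          by (simp only: scale_left scale_right complex_norm_square mult_ac)
        then show ?thesis by simp
      qed
      finally have *: "quad z = quad w + (cmod k)\<^sup>2 * quad x" .
      have w: "w \<noteq> 0 \<Longrightarrow> quad w < 0" "quad w \<le> 0"
        using N(1) k by (fastforce simp: negative_on_def w_def[symmetric])+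
      show ?thesis
      proof (cases "k = 0")
        case True
        then show ?thesis using * w z_eq z by simp
      next
        case False
        then have "(cmod k)\<^sup>2 * quad x < 0" using neg by (intro mult_pos_neg) auto
        then show ?thesis using * w by linarith
      qed
    qed
    then have "negative_on quad (span (insert x N))" by (simp add: negative_on_def)
    moreover have "span (insert x N) \<subseteq> V"
      using x N(2) assms by (intro span_minimal) (auto simp: P_def)
    ultimately have "dim (span (insert x N)) \<le> neg_index quad V" by (rule dim_le_neg_index)
    moreover have "x \<notin> N" using perpD(1)[OF xN, of x] neg by auto
    then have "x \<notin> span N" using subN by (metis span_eq_iff)
    ultimately show False using N(3) by (simp add: dim_insert)
  qed
  have "dim V \<le> dim P + dim N"
    using dim_perp_ge[OF assms subN subspace_single_0] subspace_0[OF subN]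
    by (auto simp: P_def perp_def)
  moreover have "neg_index quad V + dim P \<le> dim V"
    by (rule neg_index_add_dim_le) (use assms subP nonneg in \<open>auto simp: P_def\<close>)
  ultimately show thesis using that[OF N subP P_def nonneg] N(3) by simp
qed

text \<open>Split \<open>D\<close>, \<open>perp D\<close> and the whole space into a maximal
  negative part and its nonnegative complement. Each inequality combines the parts from
  \<open>D\<close> and \<open>perp D\<close> and compares dimensions with the whole space; the
  overlap \<open>K\<close> and the radical part \<open>R\<close> are the corrections.\<close>

theorem neg_index_perp:
  assumes "subspace D"
  shows "neg_index quad UNIV + dim (D \<inter> perp UNIV)
    = neg_index quad D + neg_index quad (perp D) + dim (D \<inter> perp D)"
proof -
  have subE: "subspace (perp D)" by (rule subspace_perp)
  obtain N1 P1 where 1: "negative_on quad N1" "N1 \<subseteq> D" "dim N1 = neg_index quad D"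
    "subspace P1" "P1 = D \<inter> perp N1" "\<And>x. x \<in> P1 \<Longrightarrow> 0 \<le> quad x" "dim N1 + dim P1 = dim D"
    by (rule neg_index_decomposition[OF assms]) blast
  obtain N2 P2 where 2: "negative_on quad N2" "N2 \<subseteq> perp D" "dim N2 = neg_index quad (perp D)"
    "subspace P2" "P2 = perp D \<inter> perp N2" "\<And>x. x \<in> P2 \<Longrightarrow> 0 \<le> quad x"
    "dim N2 + dim P2 = dim (perp D)"
    by (rule neg_index_decomposition[OF subE]) blast
  obtain N P where 0: "negative_on quad N" "dim N = neg_index quad UNIV"
    "subspace P" "P = perp N" "\<And>x. x \<in> P \<Longrightarrow> 0 \<le> quad x" "dim N + dim P = dim UNIV"
    by (rule neg_index_decomposition[OF subspace_UNIV]) (simp add: Int_UNIV_left)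
  define K where "K = D \<inter> perp D"
  define R where "R = D \<inter> perp UNIV"
  have subs: "subspace N1" "subspace N2" "subspace N" "subspace K" "subspace R"
    using 0(1) 1(1) 2(1) assms subE subspace_perp
    by (auto simp: negative_on_def K_def R_def intro: subspace_inter)
  \<comment> \<open>The space \<open>Z = N1 + N2 + K\<close> is nonpositive, and \<open>P\<close> is
    nonnegative of codimension \<open>neg_index quad UNIV\<close>. They can meet only inside
    \<open>R\<close>, which bounds \<open>dim Z\<close>.\<close>
  have "dim K + neg_index quad D + neg_index quad (perp D) \<le> neg_index quad UNIV + dim R"
  proof -
    define M where "M = {x + y |x y. x \<in> N1 \<and> y \<in> N2}"
    define Z where "Z = {x + y |x y. x \<in> M \<and> y \<in> K}"
    have subM: "subspace M" unfolding M_def by (intro subspace_sums subs)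
    have subZ: "subspace Z" unfolding Z_def by (intro subspace_sums subM subs)
    have quadM: "quad (x + y) = quad x + quad y" "quad x \<le> 0" "quad y \<le> 0"
        "quad (x + y) = 0 \<Longrightarrow> x + y = 0"
      if xy: "x \<in> N1" "y \<in> N2" for x y
    proof -
      have "h x y = 0" using perpD(1)[of y D x] xy 1 2 by blast
      then show *: "quad (x + y) = quad x + quad y" by (rule quad_add_orthogonal)
      have x: "x \<noteq> 0 \<Longrightarrow> quad x < 0" and y: "y \<noteq> 0 \<Longrightarrow> quad y < 0"
        using xy 1(1) 2(1) by (auto simp: negative_on_def)
      then show le: "quad x \<le> 0" "quad y \<le> 0" by force+
      show "x + y = 0" if "quad (x + y) = 0"
        using * x y le that by (cases "x = 0"; cases "y = 0") auto
    qed
    have M_le: "quad m \<le> 0" and M_zero: "quad m = 0 \<Longrightarrow> m = 0" if "m \<in> M" for m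
    proof -
      obtain x y where xy: "m = x + y" "x \<in> N1" "y \<in> N2" using \<open>m \<in> M\<close> by (auto simp: M_def)
      show "quad m \<le> 0" "quad m = 0 \<Longrightarrow> m = 0" using quadM[OF xy(2,3)] xy(1) by auto
    qed
    have MK: "h m k = 0" if "m \<in> M" "k \<in> K" for m k
    proof -
      obtain x y where "m = x + y" "x \<in> N1" "y \<in> N2" using \<open>m \<in> M\<close> by (auto simp: M_def)
      moreover have "h x k = 0" "h y k = 0"
        using calculation that perpD[of k D x] perpD[of y D k] 1(2) 2(2) by (auto simp: K_def)
      ultimately show ?thesis by (simp add: add_left)
    qed
    have K_zero: "quad k = 0" if "k \<in> K" for k
      using that perpD(1)[of k D k] by (simp add: K_def)
    have "N1 \<inter> N2 \<subseteq> {0}"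
    proof
      fix x assume "x \<in> N1 \<inter> N2"
      then have "h x x = 0" using perpD(1)[of x D x] 1(2) 2(2) by blast
      then show "x \<in> {0}" using 1(1) \<open>x \<in> N1 \<inter> N2\<close> by (auto simp: negative_on_def)
    qed
    then have dimM: "dim M = dim N1 + dim N2"
      unfolding M_def by (rule dim_direct_sum[OF subs(1,2)])
    have "M \<inter> K \<subseteq> {0}" using M_zero K_zero by auto
    then have dimZ: "dim Z = dim M + dim K"
      unfolding Z_def by (rule dim_direct_sum[OF subM subs(4)])
    have "Z \<inter> P \<subseteq> R"
    proof
      fix z assume z: "z \<in> Z \<inter> P"
      then obtain m k where mk: "z = m + k" "m \<in> M" "k \<in> K" by (auto simp: Z_def)
      have "quad z = quad m"
        using quad_add_orthogonal[OF MK[OF mk(2,3)]] K_zero[OF mk(3)] mk(1) by simp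
      moreover have "0 \<le> quad z" using z 0(5) by blast
      ultimately have "quad z = 0" "m = 0" using M_le[OF mk(2)] M_zero[OF mk(2)] by auto
      \<comment> \<open>Being isotropic in the nonnegative space \<open>P\<close>, \<open>z\<close>
        is orthogonal to \<open>P\<close>; it is also orthogonal to \<open>N\<close>. Since
        \<open>N + P\<close> is everything, \<open>z\<close> lies in the radical.\<close>
      have zP: "h z y = 0" if "y \<in> P" for y
        by (rule isotropic_in_nonneg_subspace[OF 0(3,5)]) (use z that \<open>quad z = 0\<close> in auto)
      have zN: "h z y = 0" if "y \<in> N" for y
        using z that perpD(2)[of z N y] 0(4) by blast
      have "N \<inter> P \<subseteq> {0}"
        using 0(1,5) by (rule negative_Int_nonneg)
      then have "dim UNIV \<le> dim {x + y |x y. x \<in> N \<and> y \<in> P}"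
        using dim_direct_sum[OF subs(3) 0(3)] 0(6) by linarith
      then have NP: "{x + y |x y. x \<in> N \<and> y \<in> P} = UNIV"
        using subspace_dim_equal[OF subspace_sums[OF subs(3) 0(3)] subspace_UNIV] by blast
      have "h y z = 0" for y
      proof -
        have "y \<in> {x + y |x y. x \<in> N \<and> y \<in> P}" using NP by simp
        then have "h z y = 0" using zP zN by (auto simp: add_right)
        then show ?thesis using conj_sym[of y z] by simp
      qed
      then show "z \<in> R" using mk \<open>m = 0\<close> by (auto simp: R_def K_def perp_def)
    qed
    then have "dim (Z \<inter> P) \<le> dim R" by (rule dim_subset)
    moreover have "dim Z + dim P \<le> dim UNIV + dim (Z \<inter> P)"
      by (rule dim_add_le_dim_Int) (use subZ 0 in auto)
    ultimately show ?thesis using dimZ dimM 0(2,6) 1(3) 2(3) by linarith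
  qed
  \<comment> \<open>Conversely \<open>P1 + P2\<close> is nonnegative, so its codimension bounds the
    index from above.\<close>
  moreover have "neg_index quad UNIV + dim R \<le> dim K + neg_index quad D + neg_index quad (perp D)"
  proof -
    define Q where "Q = {x + y |x y. x \<in> P1 \<and> y \<in> P2}"
    have "subspace Q" unfolding Q_def by (intro subspace_sums 1 2)
    have "0 \<le> quad z" if z: "z \<in> Q" for z
    proof -
      obtain x y where xy: "z = x + y" "x \<in> P1" "y \<in> P2" using z by (auto simp: Q_def)
      have "h x y = 0" using perpD(1)[of y D x] xy 1(5) 2(5) by blast
      then show ?thesis using xy 1(6) 2(6) quad_add_orthogonal by simp
    qed
    then have "neg_index quad UNIV + dim Q \<le> dim UNIV"
      by (intro neg_index_add_dim_le) (use \<open>subspace Q\<close> in auto)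
    moreover have "dim (P1 \<inter> P2) \<le> dim K"
      by (rule dim_subset) (use 1(5) 2(5) in \<open>auto simp: K_def\<close>)
    moreover have "dim Q + dim (P1 \<inter> P2) = dim P1 + dim P2"
      unfolding Q_def by (rule dim_sums_Int[OF 1(4) 2(4)])
    \<comment> \<open>The vectors of \<open>R\<close> lie in the radical and impose no condition, so
      \<open>perp D\<close> exceeds the expected dimension by at least \<open>dim R\<close>.\<close>
    moreover have "dim UNIV + dim R \<le> dim (perp D) + dim D"
    proof -
      have "R \<subseteq> D" "UNIV \<subseteq> perp R"
        using perpD(2)[of _ UNIV] by (auto simp: R_def perp_def[of "D \<inter> _"])
      from dim_perp_ge[OF subspace_UNIV assms subs(5) this] show ?thesis
        by (simp only: Int_UNIV_left)
    qed
    ultimately show ?thesis using 1(3,7) 2(3,7) by linarith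
  qed
  ultimately show ?thesis by (simp add: K_def R_def)
qed

end

section \<open>The Morse index of a Hermitian matrix\<close>

interpretation cvec: complex_space "(*s) :: complex \<Rightarrow> complex^'n \<Rightarrow> complex^'n" cart_basis ..

section \<open>The standard inner product and self-adjoint matrices\<close>

lemma cinner_add_right: "cinner x (y + z) = cinner x y + cinner x z"
  by (simp add: cinner_def algebra_simps sum.distrib)

lemma cinner_scale_right: "cinner x (c *s y) = c * cinner x y"
  by (simp add: cinner_def sum_distrib_left mult_ac)

lemma cinner_commute: "cinner y x = cnj (cinner x y)"
  by (simp add: cinner_def mult_ac)

interpretation cinner: hermitian_form "(*s) :: complex \<Rightarrow> complex^'n \<Rightarrow> complex^'n" cart_basis cinner
  by unfold_locales (rule cinner_add_right cinner_scale_right cinner_commute)+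

lemma cinner_minus_right [simp]: "cinner x (- y) = - cinner x y"
  by (simp add: cinner_def sum_negf)

lemma cinner_minus_left [simp]: "cinner (- x) y = - cinner x y"
  by (simp add: cinner_def sum_negf)

lemma cinner_diff_right: "cinner x (y - z) = cinner x y - cinner x z"
  by (simp add: cinner_def algebra_simps sum_subtractf)

lemma cinner_diff_left: "cinner (x - y) z = cinner x z - cinner y z"
  by (simp add: cinner_def algebra_simps sum_subtractf)

lemma Re_cinner: "Re (cinner x y) = x \<bullet> y"
  by (simp add: cinner_def inner_vec_def inner_complex_def)

lemma cinner_self: "cinner x x = of_real ((norm x)\<^sup>2)"
proof (rule complex_eqI)
  show "Re (cinner x x) = Re (of_real ((norm x)\<^sup>2))"
    by (simp add: Re_cinner power2_norm_eq_inner)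
  show "Im (cinner x x) = Im (of_real ((norm x)\<^sup>2))"
    using cinner_commute[of x x] by (simp add: complex_eq_iff)
qed

lemma cinner_self_eq_0 [simp]: "cinner x x = 0 \<longleftrightarrow> x = 0"
  by (simp add: cinner_self)

lemma cinner_axis_left: "cinner (axis i 1) y = y $ i"
proof -
  have "cinner (axis i 1) y = (\<Sum>j\<in>UNIV. if j = i then y $ j else 0)"
    unfolding cinner_def by (rule sum.cong) (auto simp: axis_def)
  then show ?thesis by simp
qed

lemma cinner_ext:
  assumes "\<And>x. cinner x y = cinner x z"
  shows "y = z"
  using assms cinner_axis_left by (metis vec_eq_iff)

lemma scaleR_eq_vector_scale: "r *\<^sub>R (x :: complex^'n) = complex_of_real r *s x"
  by (simp only: vec_eq_iff vector_scaleR_component vector_smult_component) (simp add: scaleR_conv_of_real)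

lemma hermitian_iff_self_adjoint:
  "hermitian A \<longleftrightarrow> (\<forall>x y. cinner (A *v x) y = cinner x (A *v y))"
proof
  assume A: "hermitian A"
  show "\<forall>x y. cinner (A *v x) y = cinner x (A *v y)"
  proof (intro allI)
    fix x y :: "complex^'a"
    have "cinner (A *v x) y = (\<Sum>i\<in>UNIV. \<Sum>j\<in>UNIV. cnj (A $ i $ j) * cnj (x $ j) * y $ i)"
      by (simp add: cinner_def matrix_vector_mult_def sum_distrib_right)
    also have "\<dots> = (\<Sum>j\<in>UNIV. \<Sum>i\<in>UNIV. cnj (A $ i $ j) * cnj (x $ j) * y $ i)"
      by (rule sum.swap)
    also have "\<dots> = (\<Sum>j\<in>UNIV. \<Sum>i\<in>UNIV. cnj (x $ j) * (A $ j $ i * y $ i))"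
    proof (intro sum.cong refl)
      fix i j
      have "cnj (A $ i $ j) = A $ j $ i" using A unfolding hermitian_def by metis
      then show "cnj (A $ i $ j) * cnj (x $ j) * y $ i = cnj (x $ j) * (A $ j $ i * y $ i)"
        by (simp add: mult_ac)
    qed
    also have "\<dots> = cinner x (A *v y)"
      by (simp add: cinner_def matrix_vector_mult_def sum_distrib_left)
    finally show "cinner (A *v x) y = cinner x (A *v y)" .
  qed
next
  assume *: "\<forall>x y. cinner (A *v x) y = cinner x (A *v y)"
  have entry: "cinner (axis i 1) (A *v axis j 1) = A $ i $ j" for i j
    unfolding cinner_axis_left by (simp add: matrix_vector_mult_def axis_def if_distrib cong: if_cong)
  show "hermitian A"
    unfolding hermitian_def
  proof (intro allI)
    fix i j
    have "A $ j $ i = cinner (A *v axis j 1) (axis i 1)" using * entry by metis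
    also have "\<dots> = cnj (A $ i $ j)" using entry cinner_commute by metis
    finally show "A $ j $ i = cnj (A $ i $ j)" .
  qed
qed

lemma cinner_hermitian: "hermitian A \<Longrightarrow> cinner (A *v x) y = cinner x (A *v y)"
  by (simp add: hermitian_iff_self_adjoint)

lemma hermitian_form_matrix:
  assumes "hermitian A"
  shows "hermitian_form (*s) cart_basis (\<lambda>x y. cinner x (A *v y))"
proof unfold_locales
  show "cinner y (A *v x) = cnj (cinner x (A *v y))" for x y
    using cinner_hermitian[OF assms] cinner_commute by metis
qed (simp_all add: matrix_vector_right_distrib cinner_add_right vec.scale cinner_scale_right)

text \<open>The real part of \<open>cinner\<close> is the real inner product, so the vectors are
  orthogonal and hence independent over the reals. This yields finiteness of the negative spectrum
  here and of the exceptional parameters \<open>t\<close> later.\<close>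

lemma finite_orthogonal_family:
  fixes f :: "'a \<Rightarrow> complex^'n"
  assumes nz: "\<And>t. t \<in> T \<Longrightarrow> f t \<noteq> 0"
    and orth: "\<And>s t. s \<in> T \<Longrightarrow> t \<in> T \<Longrightarrow> s \<noteq> t \<Longrightarrow> cinner (f s) (f t) = 0"
  shows "finite T"
proof -
  have "inj_on f T"
  proof (rule inj_onI)
    fix s t assume st: "s \<in> T" "t \<in> T" "f s = f t"
    then show "s = t" using orth[of s t] nz[of s] by (auto simp: cinner_self)
  qed
  have "pairwise orthogonal (f ` T)"
    unfolding pairwise_def orthogonal_def Re_cinner[symmetric]
  proof safe
    fix s t assume "s \<in> T" "t \<in> T" "f s \<noteq> f t"
    then have "cinner (f s) (f t) = 0" using orth[of s t] by blast
    then show "Re (cinner (f s) (f t)) = 0" by simp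
  qed
  moreover have "0 \<notin> f ` T" using nz by force
  ultimately have "independent (f ` T)" by (rule pairwise_orthogonal_independent)
  then have "finite (f ` T)" by (rule independent_imp_finite)
  then show ?thesis using \<open>inj_on f T\<close> finite_imageD by blast
qed

lemma subspace_vec_imp_real:
  fixes V :: "(complex^'n) set"
  assumes "vec.subspace V"
  shows "subspace V"
  using assms by (auto simp: subspace_def vec.subspace_def scaleR_eq_vector_scale)

text \<open>A minimiser of the Rayleigh quotient on \<open>V\<close> is isotropic for the form of \<open>A - r\<close>, which is
  nonnegative on \<open>V\<close> when \<open>r\<close> is the minimum.\<close>

lemma exists_negative_eigenvector:
  fixes A :: "complex^'n^'n"
  assumes A: "hermitian A" and V: "vec.subspace V" and inv: "\<And>x. x \<in> V \<Longrightarrow> A *v x \<in> V"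
    and x0: "x0 \<in> V" "Re (cinner x0 (A *v x0)) < 0"
  obtains x r where "x \<in> V" "x \<noteq> 0" "r < 0" "A *v x = complex_of_real r *s x"
proof -
  let ?q = "\<lambda>x. Re (cinner x (A *v x))"
  have q_scale: "?q (complex_of_real a *s x) = a\<^sup>2 * ?q x" for a x
    by (simp add: vec.scale cinner_scale_right cinner.scale_left power2_eq_square)
  define K where "K = V \<inter> sphere 0 1"
  have "compact K"
    unfolding K_def by (intro closed_Int_compact closed_subspace subspace_vec_imp_real V compact_sphere)
  have normalize: "complex_of_real (1 / norm y) *s y \<in> K" if "y \<in> V" "y \<noteq> 0" for y
    using that vec.subspace_scale[OF V]
    by (simp add: K_def scaleR_eq_vector_scale[symmetric] del: of_real_divide)
      (simp add: scaleR_eq_vector_scale)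
  have "x0 \<noteq> 0" using x0(2) by auto
  then have "K \<noteq> {}" using normalize x0 by blast
  moreover have "continuous_on K ?q"
    unfolding Re_cinner by (intro continuous_intros matrix_vector_mult_linear_continuous_on)
  ultimately obtain x where x: "x \<in> K" and min: "\<And>y. y \<in> K \<Longrightarrow> ?q x \<le> ?q y"
    using continuous_attains_inf[OF \<open>compact K\<close>] by meson
  have xV: "x \<in> V" and nx: "norm x = 1" using x by (auto simp: K_def)
  define r where "r = ?q x"
  have ge: "r * (norm y)\<^sup>2 \<le> ?q y" if "y \<in> V" for y
  proof (cases "y = 0")
    case False
    have "r \<le> ?q (complex_of_real (1 / norm y) *s y)"
      unfolding r_def by (rule min[OF normalize[OF that False]])
    also have "\<dots> = (1 / norm y)\<^sup>2 * ?q y" by (rule q_scale)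
    finally show ?thesis using False by (simp add: field_simps power2_eq_square)
  qed simp
  have "r < 0"
  proof (rule ccontr)
    assume "\<not> r < 0"
    then have "0 \<le> r * (norm x0)\<^sup>2" by simp
    then show False using ge[OF x0(1)] x0(2) by linarith
  qed
  define h where "h = (\<lambda>x y. cinner x (A *v y) - complex_of_real r * cinner x y)"
  interpret h: hermitian_form "(*s)" cart_basis h
  proof unfold_locales
    show "h y x = cnj (h x y)" for x y
      using cinner_hermitian[OF A] cinner_commute by (metis h_def complex_cnj_diff
          complex_cnj_mult complex_cnj_complex_of_real)
  qed (simp_all add: h_def matrix_vector_right_distrib cinner_add_right vec.scale cinner_scale_right
      algebra_simps)
  have quad_h: "Re (h y y) = ?q y - r * (norm y)\<^sup>2" for y
    by (simp add: h_def cinner_self)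
  \<comment> \<open>Because \<open>A - r\<close> is self-adjoint, \<open>h x w\<close> equals
    \<open>cinner w w\<close>. Isotropy of \<open>x\<close> therefore makes the residual
    \<open>w\<close> of the eigenvalue equation vanish.\<close>
  define w where "w = A *v x - complex_of_real r *s x"
  have "w \<in> V"
    unfolding w_def by (intro vec.subspace_diff vec.subspace_scale V inv xV)
  have "h x w = 0"
    by (rule h.isotropic_in_nonneg_subspace[OF V])
      (use xV \<open>w \<in> V\<close> ge nx in \<open>auto simp: quad_h r_def\<close>)
  then have "cinner w w = 0"
    by (simp add: h_def w_def cinner_diff_left cinner.scale_left cinner_hermitian[OF A])
  then have "A *v x = complex_of_real r *s x" by (simp add: w_def)
  then show thesis using that xV nx \<open>r < 0\<close> by force
qed

section \<open>The variational index and the count of negative eigenvalues\<close>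

definition matrix_neg_index :: "complex^'n^'n \<Rightarrow> nat" where
  "matrix_neg_index A = cvec.neg_index (\<lambda>x. Re (cinner x (A *v x))) UNIV"

lemma subspace_eigenspace: "vec.subspace (eigenspace A c)"
  by (rule vec.subspaceI)
    (simp_all add: eigenspace_def matrix_vector_right_distrib vec.scale vector_scalar_commute vector_add_ldistrib mult.commute)

lemma eigenspaces_orthogonal:
  fixes r s :: real
  assumes "hermitian A" "r \<noteq> s" "x \<in> eigenspace A r" "y \<in> eigenspace A s"
  shows "cinner x y = 0"
proof -
  have "r * cinner x y = cinner (A *v x) y" using assms by (simp add: eigenspace_def cinner.scale_left)
  also have "\<dots> = cinner x (A *v y)" by (rule cinner_hermitian[OF assms(1)])
  also have "\<dots> = s * cinner x y" using assms(4) by (simp add: eigenspace_def cinner_scale_right)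
  finally show ?thesis using assms(2) by simp
qed

text \<open>The span of the negative eigenspaces is negative. Its orthogonal complement is invariant
  under \<open>A\<close>, so a negative value there would produce another negative eigenvector,
  orthogonal to itself. The two spaces certify the index.\<close>

theorem matrix_neg_index_eq_morse_index:
  fixes A :: "complex^'n^'n"
  assumes A: "hermitian A"
  shows "matrix_neg_index A = morse_index A"
proof -
  let ?q = "\<lambda>x. Re (cinner x (A *v x))"
  interpret A: hermitian_form "(*s)" cart_basis "\<lambda>x y. cinner x (A *v y)"
    by (rule hermitian_form_matrix[OF A])
  define R where "R = {r. r < 0 \<and> eigenvalue A (complex_of_real r)}"
  \<comment> \<open>One eigenvector per negative eigenvalue gives an orthogonal family, so
    \<open>R\<close> is finite. This permits the induction, and the sum in
    \<open>morse_index\<close> is not the default value of an infinite sum.\<close>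
  have "\<exists>f. \<forall>r\<in>R. f r \<noteq> 0 \<and> f r \<in> eigenspace A (complex_of_real r)"
    by (rule bchoice) (auto simp: R_def eigenvalue_def eigenspace_def)
  then obtain f where f: "\<And>r. r \<in> R \<Longrightarrow> f r \<noteq> 0"
    "\<And>r. r \<in> R \<Longrightarrow> f r \<in> eigenspace A (complex_of_real r)"
    by blast
  have "finite R"
    by (rule finite_orthogonal_family[of R f]) (use f eigenspaces_orthogonal[OF A] in blast)+
  define N where "N = (\<lambda>F. vec.span (\<Union>r\<in>F. eigenspace A (complex_of_real r)))"
  have N: "cvec.negative_on ?q (N F) \<and> vec.dim (N F) = (\<Sum>r\<in>F. vec.dim (eigenspace A (complex_of_real r)))"
    if "finite F" "F \<subseteq> R" for F
    using that
  proof (induction F rule: finite_induct)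
    case empty
    then show ?case by (simp add: N_def cvec.negative_on_def)
  next
    case (insert r F)
    let ?E = "eigenspace A (complex_of_real r)"
    have IH: "cvec.negative_on ?q (N F)"
      "vec.dim (N F) = (\<Sum>r\<in>F. vec.dim (eigenspace A (complex_of_real r)))"
      using insert by auto
    have "r < 0" using insert.prems by (simp add: R_def)
    have NF: "vec.subspace (N F)" by (simp add: N_def)
    have "N F \<subseteq> cinner.perp ?E"
      unfolding N_def
    proof (rule vec.span_minimal[OF _ cinner.subspace_perp], safe)
      fix s y assume "s \<in> F" "y \<in> eigenspace A (complex_of_real s)"
      then show "y \<in> cinner.perp ?E"
        using eigenspaces_orthogonal[OF A, of r s] insert.hyps by (auto simp: cinner.perp_def)
    qed
    then have orth: "cinner x y = 0" if "x \<in> ?E" "y \<in> N F" for x y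
      using that cinner.perpD by blast
    have N_insert: "N (insert r F) = {x + y |x y. x \<in> ?E \<and> y \<in> N F}"
      using vec.span_Un[of ?E "\<Union>r\<in>F. eigenspace A (complex_of_real r)"]
        vec.span_eq_iff[THEN iffD2, OF subspace_eigenspace[of A "complex_of_real r"]]
      by (simp add: N_def)
    have "?E \<inter> N F \<subseteq> {0}" using orth cinner_self_eq_0 by blast
    then have "vec.dim (N (insert r F)) = vec.dim ?E + vec.dim (N F)"
      unfolding N_insert by (intro cvec.dim_direct_sum subspace_eigenspace NF)
    moreover have "?q z < 0" if z: "z \<in> N (insert r F)" "z \<noteq> 0" for z
    proof -
      obtain x y where xy: "z = x + y" "x \<in> ?E" "y \<in> N F" using z N_insert by auto
      \<comment> \<open>The cross term vanishes: \<open>A *v x\<close> is a multiple of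
        \<open>x\<close>, which is orthogonal to \<open>y\<close>.\<close>
      have "cinner x (A *v y) = cinner (A *v x) y" by (simp add: cinner_hermitian[OF A])
      also have "\<dots> = 0" using xy orth by (simp add: eigenspace_def cinner.scale_left)
      finally have "?q z = ?q x + ?q y" using A.quad_add_orthogonal xy by simp
      moreover have "?q x = r * (norm x)\<^sup>2"
        using xy(2) by (simp add: eigenspace_def cinner_scale_right cinner_self)
      moreover have "?q y < 0 \<or> y = 0" using IH(1) xy(3) by (auto simp: cvec.negative_on_def)
      moreover have "r * (norm x)\<^sup>2 < 0 \<or> x = 0" using \<open>r < 0\<close> by (simp add: mult_less_0_iff)
      ultimately show ?thesis using xy(1) z(2) by auto
    qed
    ultimately show ?case
      using IH insert.hyps by (simp add: cvec.negative_on_def) (simp add: N_def)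
  qed
  define P where "P = cinner.perp (N R)"
  have P_eq: "P = cinner.perp (\<Union>r\<in>R. eigenspace A (complex_of_real r))"
    unfolding P_def N_def by (rule cinner.perp_span)
  have subP: "vec.subspace P" unfolding P_def by (rule cinner.subspace_perp)
  have inv: "A *v x \<in> P" if "x \<in> P" for x
    unfolding P_eq cinner.perp_def
  proof (rule CollectI, safe)
    fix r y assume ry: "r \<in> R" "y \<in> eigenspace A (complex_of_real r)"
    then have "cinner y x = 0" using that by (auto simp: P_eq cinner.perp_def)
    then show "cinner y (A *v x) = 0"
      using ry(2) by (simp add: cinner_hermitian[OF A, symmetric] eigenspace_def cinner.scale_left)
  qed
  have nonneg: "0 \<le> ?q x" if xP: "x \<in> P" for x
  proof (rule ccontr)
    assume "\<not> 0 \<le> ?q x"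
    then obtain z r where zr: "z \<in> P" "z \<noteq> 0" "r < 0" "A *v z = complex_of_real r *s z"
      using exists_negative_eigenvector[of A P x] A subP inv xP by (metis not_le)
    then have "r \<in> R" "z \<in> eigenspace A (complex_of_real r)"
      by (auto simp: R_def eigenvalue_def eigenspace_def)
    then have "cinner z z = 0" using zr(1) by (auto simp: P_eq cinner.perp_def)
    then show False using zr(2) by simp
  qed
  have dim: "vec.dim (UNIV :: (complex^'n) set) \<le> vec.dim (N R) + vec.dim P"
    using cinner.dim_perp_ge[OF vec.subspace_UNIV, of "N R" "{0}"] vec.subspace_0[of "N R"]
    by (simp add: N_def P_def cinner.perp_def)
  have NR: "cvec.negative_on ?q (N R)" "vec.dim (N R) = morse_index A"
    using N[OF \<open>finite R\<close> order_refl] by (auto simp: morse_index_def R_def)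
  have "cvec.neg_index ?q UNIV = vec.dim (N R)"
    by (rule cvec.neg_index_unique[OF vec.subspace_UNIV NR(1) subset_UNIV subP subset_UNIV nonneg dim])
  then show ?thesis by (simp add: matrix_neg_index_def NR(2))
qed

section \<open>The index of a triple of planes\<close>

interpretation cplane: complex_space "cplane.scale :: complex \<Rightarrow> 'n::finite cplane \<Rightarrow> 'n cplane"
  cplane.Basis_pair ..

interpretation cpair: finite_dimensional_vector_space_prod
  "cplane.scale :: complex \<Rightarrow> 'n::finite cplane \<Rightarrow> 'n cplane"
  "cplane.scale :: complex \<Rightarrow> 'n::finite cplane \<Rightarrow> 'n cplane"
  cplane.Basis_pair cplane.Basis_pair ..

interpretation cpair: complex_space
  "cpair.scale :: complex \<Rightarrow> 'n::finite cplane \<times> 'n cplane \<Rightarrow> 'n cplane \<times> 'n cplane"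
  cpair.Basis_pair ..

interpretation vec_plane: complex_space_pair "(*s) :: complex \<Rightarrow> complex^'n \<Rightarrow> complex^'n" cart_basis
  "cplane.scale :: complex \<Rightarrow> 'n::finite cplane \<Rightarrow> 'n cplane" cplane.Basis_pair ..

interpretation vec_pair: complex_space_pair "(*s) :: complex \<Rightarrow> complex^'n \<Rightarrow> complex^'n" cart_basis
  "cpair.scale :: complex \<Rightarrow> 'n::finite cplane \<times> 'n cplane \<Rightarrow> 'n cplane \<times> 'n cplane" cpair.Basis_pair ..

interpretation plane_pair: complex_space_pair
  "cplane.scale :: complex \<Rightarrow> 'n::finite cplane \<Rightarrow> 'n cplane" cplane.Basis_pair
  "cpair.scale :: complex \<Rightarrow> 'n::finite cplane \<times> 'n cplane \<Rightarrow> 'n cplane \<times> 'n cplane" cpair.Basis_pair ..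

interpretation pair_pair: complex_space_pair
  "cpair.scale :: complex \<Rightarrow> 'n::finite cplane \<times> 'n cplane \<Rightarrow> 'n cplane \<times> 'n cplane" cpair.Basis_pair
  "cpair.scale :: complex \<Rightarrow> 'n::finite cplane \<times> 'n cplane \<Rightarrow> 'n cplane \<times> 'n cplane" cpair.Basis_pair ..

text \<open>The usual form on \<open>{(x\<^sub>1, x\<^sub>2, x\<^sub>3) \<in> L1 \<times> L2 \<times> L3. x\<^sub>1 + x\<^sub>2 + x\<^sub>3 = 0}\<close> with \<open>x\<^sub>2\<close> eliminated.\<close>

definition triple_space :: "'n::finite cplane set \<Rightarrow> 'n cplane set \<Rightarrow> 'n cplane set \<Rightarrow> ('n cplane \<times> 'n cplane) set" where
  "triple_space L1 L2 L3 = {(x, y). x \<in> L1 \<and> y \<in> L3 \<and> x + y \<in> L2}"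

text \<open>For isotropic planes the real part loses nothing: expanding
  \<open>symp_form (x + y) (x + y) = 0\<close> shows that \<open>symp_form x y\<close> is real on
  the triple space.\<close>

definition triple_quad :: "'n::finite cplane \<times> 'n cplane \<Rightarrow> real" where
  "triple_quad = (\<lambda>(x, y). Re (symp_form x y))"

definition duistermaat_index :: "'n::finite cplane set \<Rightarrow> 'n cplane set \<Rightarrow> 'n cplane set \<Rightarrow> nat" where
  "duistermaat_index L1 L2 L3 = cpair.neg_index triple_quad (triple_space L1 L2 L3)
     + cplane.p.dim (L1 \<inter> L3) - cplane.p.dim (L1 \<inter> L2 \<inter> L3)"

text \<open>The triple intersection lies in \<open>L1 \<inter> L3\<close>, so the subtraction of
  naturals in the definition never truncates.\<close>

lemma duistermaat_index_add_dim:
  "duistermaat_index L1 L2 L3 + cplane.p.dim (L1 \<inter> L2 \<inter> L3)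
     = cpair.neg_index triple_quad (triple_space L1 L2 L3) + cplane.p.dim (L1 \<inter> L3)"
proof -
  have "cplane.p.dim (L1 \<inter> L2 \<inter> L3) \<le> cplane.p.dim (L1 \<inter> L3)"
    by (rule cplane.p.dim_subset) blast
  then show ?thesis by (simp add: duistermaat_index_def)
qed

lemma subspace_triple_space:
  assumes "cplane.p.subspace L1" "cplane.p.subspace L2" "cplane.p.subspace L3"
  shows "cpair.p.subspace (triple_space L1 L2 L3)"
proof (rule cpair.p.subspaceI)
  show "0 \<in> triple_space L1 L2 L3"
    using assms cplane.p.subspace_0 by (auto simp: triple_space_def zero_prod_def)
next
  fix z w assume "z \<in> triple_space L1 L2 L3" "w \<in> triple_space L1 L2 L3"
  then obtain x y x' y' where *: "z = (x, y)" "w = (x', y')" "x \<in> L1" "y \<in> L3" "x + y \<in> L2"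
    "x' \<in> L1" "y' \<in> L3" "x' + y' \<in> L2"
    by (auto simp: triple_space_def)
  have "(x + x') + (y + y') = (x + y) + (x' + y')" by (simp add: algebra_simps)
  then show "z + w \<in> triple_space L1 L2 L3"
    using * assms cplane.p.subspace_add unfolding triple_space_def by (metis (mono_tags, lifting) add_Pair case_prodI mem_Collect_eq)
next
  fix c z assume "z \<in> triple_space L1 L2 L3"
  then obtain x y where *: "z = (x, y)" "x \<in> L1" "y \<in> L3" "x + y \<in> L2"
    by (auto simp: triple_space_def)
  moreover have "cplane.scale c x \<in> L1" "cplane.scale c y \<in> L3" "cplane.scale c (x + y) \<in> L2"
    using * assms cplane.p.subspace_scale by blast+
  ultimately show "cpair.scale c z \<in> triple_space L1 L2 L3"
    by (simp add: triple_space_def cpair.scale_prod cplane.p.scale_right_distrib)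
qed

lemma duistermaat_index_symplectic:
  fixes S :: "'n::finite cplane \<Rightarrow> 'n cplane"
  assumes S: "symplectic S"
    and L: "cplane.p.subspace L1" "cplane.p.subspace L2" "cplane.p.subspace L3"
  shows "duistermaat_index (S ` L1) (S ` L2) (S ` L3) = duistermaat_index L1 L2 L3"
proof -
  have lin: "Vector_Spaces.linear cplane.scale cplane.scale S" and "bij S"
    and form: "\<And>u v. symp_form (S u) (S v) = symp_form u v"
    using S by (auto simp: symplectic_def)
  have inj: "inj S" using \<open>bij S\<close> by (rule bij_is_inj)
  interpret S: Vector_Spaces.linear cplane.scale cplane.scale S by (rule lin)
  have dim: "cplane.p.dim (S ` M) = cplane.p.dim M" for M
    by (rule cpair.dim_image_eq[OF lin]) (use inj inj_on_subset in blast)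
  let ?f = "map_prod S S"
  have "Vector_Spaces.linear cpair.scale cpair.scale ?f"
    by unfold_locales (simp_all add: prod_eq_iff[where 'a="'n cplane"] cpair.scale_def S.add S.scale)
  moreover have "inj_on ?f (triple_space L1 L2 L3)"
    using inj by (metis inj_on_subset prod.inj_map subset_UNIV)
  ultimately have "cpair.neg_index triple_quad (?f ` triple_space L1 L2 L3)
      = cpair.neg_index triple_quad (triple_space L1 L2 L3)"
    by (rule pair_pair.neg_index_image[OF _ _ subspace_triple_space[OF L]])
      (auto simp: triple_quad_def form)
  moreover have "?f ` triple_space L1 L2 L3 = triple_space (S ` L1) (S ` L2) (S ` L3)"
  proof -
    have "S x + S y \<in> S ` L2 \<longleftrightarrow> x + y \<in> L2" for x y
      using inj by (simp only: S.add[symmetric] inj_image_mem_iff)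
    then show ?thesis by (force simp: triple_space_def)
  qed
  ultimately show ?thesis
    unfolding duistermaat_index_def by (simp add: dim flip: image_Int[OF inj])
qed

section \<open>The index of triples of graphs\<close>

lemma linear_vec_plane:
  fixes A B :: "complex^'n::finite^'n"
  shows "Vector_Spaces.linear (*s) cplane.scale (\<lambda>x. (A *v x, B *v x))"
  by unfold_locales (auto simp: cplane.scale_def matrix_vector_right_distrib vec.scale)

lemma graph_plane_eq: "graph_plane A = range (\<lambda>x. (x, A *v x))"
  by (auto simp: graph_plane_def)

lemma mem_graph_plane [simp]: "(x, y) \<in> graph_plane A \<longleftrightarrow> y = A *v x"
  by (auto simp: graph_plane_def)

lemma symp_form_Pair: "symp_form (x, y) (x', y') = cinner x y' - cinner y x'"
  by (simp add: symp_form_def)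

lemma hermitian_diff: "hermitian A \<Longrightarrow> hermitian B \<Longrightarrow> hermitian (A - B)"
  unfolding hermitian_iff_self_adjoint
  by (simp add: matrix_vector_mult_diff_rdistrib cinner_diff_left cinner_diff_right)

lemma hermitian_form_direct_sum:
  assumes "hermitian A" "hermitian B"
  shows "hermitian_form cplane.scale cplane.Basis_pair
    (\<lambda>z w. cinner (fst z) (A *v fst w) + cinner (snd z) (B *v snd w))"
proof unfold_locales
  show "cinner (fst y) (A *v fst x) + cinner (snd y) (B *v snd x) =
      cnj (cinner (fst x) (A *v fst y) + cinner (snd x) (B *v snd y))" for x y
    using cinner_hermitian[OF assms(1)] cinner_hermitian[OF assms(2)] cinner_commute
    by (metis complex_cnj_add)
qed (simp_all add: matrix_vector_right_distrib cinner_add_right vec.scale cinner_scale_right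
    cplane.scale_def algebra_simps)

text \<open>Products of the negative parts and of the nonnegative parts of both summands have
  complementary dimensions and certify the index.\<close>

lemma neg_index_direct_sum:
  fixes A B :: "complex^'n::finite^'n"
  assumes A: "hermitian A" and B: "hermitian B"
  shows "cplane.neg_index (\<lambda>z. Re (cinner (fst z) (A *v fst z) + cinner (snd z) (B *v snd z))) UNIV
    = matrix_neg_index A + matrix_neg_index B"
proof -
  let ?qA = "\<lambda>x. Re (cinner x (A *v x))" and ?qB = "\<lambda>x. Re (cinner x (B *v x))"
  let ?q = "\<lambda>z. Re (cinner (fst z) (A *v fst z) + cinner (snd z) (B *v snd z))"
  interpret A: hermitian_form "(*s)" cart_basis "\<lambda>x y. cinner x (A *v y)"
    by (rule hermitian_form_matrix[OF A])
  interpret B: hermitian_form "(*s)" cart_basis "\<lambda>x y. cinner x (B *v y)"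
    by (rule hermitian_form_matrix[OF B])
  obtain NA PA where NA: "cvec.negative_on ?qA NA" "vec.dim NA = matrix_neg_index A"
    and PA: "vec.subspace PA" "\<And>x. x \<in> PA \<Longrightarrow> 0 \<le> ?qA x"
    and dimA: "vec.dim NA + vec.dim PA = vec.dim (UNIV :: (complex^'n) set)"
    unfolding matrix_neg_index_def by (rule A.neg_index_decomposition[OF vec.subspace_UNIV]) blast
  obtain NB PB where NB: "cvec.negative_on ?qB NB" "vec.dim NB = matrix_neg_index B"
    and PB: "vec.subspace PB" "\<And>x. x \<in> PB \<Longrightarrow> 0 \<le> ?qB x"
    and dimB: "vec.dim NB + vec.dim PB = vec.dim (UNIV :: (complex^'n) set)"
    unfolding matrix_neg_index_def by (rule B.neg_index_decomposition[OF vec.subspace_UNIV]) blast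
  have subN: "vec.subspace NA" "vec.subspace NB"
    using NA(1) NB(1) by (auto simp: cvec.negative_on_def)
  have "?q z < 0" if z: "z \<in> NA \<times> NB" "z \<noteq> 0" for z
  proof -
    obtain x y where xy: "z = (x, y)" "x \<in> NA" "y \<in> NB" using z by auto
    then have "x = 0 \<or> ?qA x < 0" "y = 0 \<or> ?qB y < 0" "x \<noteq> 0 \<or> y \<noteq> 0"
      using NA(1) NB(1) z(2) by (auto simp: cvec.negative_on_def zero_prod_def)
    then show ?thesis using xy(1) by auto
  qed
  then have N: "cplane.negative_on ?q (NA \<times> NB)"
    using cplane.subspace_Times[OF subN] by (simp only: cplane.negative_on_def) blast
  have P: "cplane.p.subspace (PA \<times> PB)" by (rule cplane.subspace_Times[OF PA(1) PB(1)])
  have nonneg: "0 \<le> ?q z" if "z \<in> PA \<times> PB" for z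
    using that PA(2) PB(2) by auto
  have "cplane.p.dim (UNIV :: 'n cplane set) = vec.dim (UNIV :: (complex^'n) set) + vec.dim (UNIV :: (complex^'n) set)"
    using cplane.dim_Times[OF vec.subspace_UNIV vec.subspace_UNIV] unfolding UNIV_Times_UNIV .
  then have "cplane.p.dim (UNIV :: 'n cplane set) \<le> cplane.p.dim (NA \<times> NB) + cplane.p.dim (PA \<times> PB)"
    using cplane.dim_Times[OF subN] cplane.dim_Times[OF PA(1) PB(1)] dimA dimB by linarith
  from cplane.neg_index_unique[OF cplane.p.subspace_UNIV N subset_UNIV P subset_UNIV nonneg this]
  show ?thesis using cplane.dim_Times[OF subN] NA(2) NB(2) by simp
qed

text \<open>Both forms, hence their sum, are negative on the intersection of the two maximal
  negative subspaces. This becomes the upper bound \<open>CARD('n)\<close> for the index.\<close>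

lemma matrix_neg_index_add_le:
  fixes A B :: "complex^'n::finite^'n"
  shows "matrix_neg_index A + matrix_neg_index B \<le> CARD('n) + matrix_neg_index (A + B)"
proof -
  let ?q = "\<lambda>A x. Re (cinner x (A *v x))"
  obtain NA where NA: "cvec.negative_on (?q A) NA" "vec.dim NA = matrix_neg_index A"
    unfolding matrix_neg_index_def by (rule cvec.neg_index_attained[OF vec.subspace_UNIV]) blast
  obtain NB where NB: "cvec.negative_on (?q B) NB" "vec.dim NB = matrix_neg_index B"
    unfolding matrix_neg_index_def by (rule cvec.neg_index_attained[OF vec.subspace_UNIV]) blast
  have subN: "vec.subspace NA" "vec.subspace NB"
    using NA(1) NB(1) by (auto simp: cvec.negative_on_def)
  have "?q (A + B) x = ?q A x + ?q B x" for x
    by (simp add: matrix_vector_mult_add_rdistrib cinner_add_right)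
  then have "cvec.negative_on (?q (A + B)) (NA \<inter> NB)"
    using NA(1) NB(1) by (fastforce simp: cvec.negative_on_def intro: vec.subspace_inter)
  then have "vec.dim (NA \<inter> NB) \<le> matrix_neg_index (A + B)"
    unfolding matrix_neg_index_def by (rule cvec.dim_le_neg_index) simp
  moreover have "vec.dim NA + vec.dim NB \<le> vec.dim (UNIV :: (complex^'n) set) + vec.dim (NA \<inter> NB)"
    by (rule cvec.dim_add_le_dim_Int) (use subN in auto)
  moreover have "vec.dim (UNIV :: (complex^'n) set) = CARD('n)"
    by (simp add: card_cart_basis)
  ultimately show ?thesis using NA(2) NB(2) by linarith
qed

text \<open>Inertia of the form \<open>(A2 - A1) \<oplus> (A3 - A2)\<close> relative to the antidiagonal.\<close>

theorem duistermaat_index_graphs: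
  fixes A1 A2 A3 :: "complex^'n::finite^'n"
  assumes h1: "hermitian A1" and h2: "hermitian A2" and h3: "hermitian A3"
  shows "duistermaat_index (graph_plane A1) (graph_plane A2) (graph_plane A3) + matrix_neg_index (A3 - A1)
    = matrix_neg_index (A2 - A1) + matrix_neg_index (A3 - A2)"
proof -
  define A where "A = A2 - A1"
  define B where "B = A3 - A2"
  have A: "hermitian A" and B: "hermitian B" unfolding A_def B_def by (intro hermitian_diff h1 h2 h3)+
  define h where "h = (\<lambda>z w. cinner (fst z) (A *v fst w) + cinner (snd z) (B *v snd w))"
  interpret h: hermitian_form cplane.scale cplane.Basis_pair h
    unfolding h_def by (rule hermitian_form_direct_sum[OF A B])
  define d where "d = (\<lambda>x :: complex^'n. (x, - x))"
  have lin_d: "Vector_Spaces.linear (*s) cplane.scale d"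
    by unfold_locales (auto simp: d_def cplane.scale_def)
  have inj_d: "inj d" by (simp add: d_def inj_on_def)
  define D where "D = range d"
  have subD: "cplane.p.subspace D"
    unfolding D_def using lin_d vec.subspace_UNIV
    by (simp add: Vector_Spaces.linear.axioms vec_plane.linear_subspace_image)
  \<comment> \<open>The condition \<open>A *v u = B *v v\<close> says
    \<open>A1 *v u + A3 *v v = A2 *v (u + v)\<close>, so this space parametrizes the triple space of
    the graphs.\<close>
  have perp_D: "h.perp D = {(u, v). A *v u = B *v v}"
  proof -
    have "h (d x) (u, v) = cinner x (A *v u) - cinner x (B *v v)" for x u v
      by (simp add: h_def d_def)
    then have "(u, v) \<in> h.perp D \<longleftrightarrow> A *v u = B *v v" for u v
      using cinner_ext[of "A *v u" "B *v v"] by (auto simp: h.perp_def D_def)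
    then show ?thesis by auto
  qed
  have perp_UNIV: "h.perp UNIV = {(u, v). A *v u = 0 \<and> B *v v = 0}"
  proof -
    have "A *v u = 0 \<and> B *v v = 0" if "\<And>x y. cinner x (A *v u) + cinner y (B *v v) = 0" for u v
      using that[of _ 0] that[of 0] cinner_ext[of "A *v u" 0] cinner_ext[of "B *v v" 0] by simp
    then have "(u, v) \<in> h.perp UNIV \<longleftrightarrow> A *v u = 0 \<and> B *v v = 0" for u v
      unfolding h.perp_def by (auto simp: h_def)
    then show ?thesis by auto
  qed
  have dim_d: "cplane.p.dim (d ` M) = vec.dim M" for M
    by (rule vec_plane.dim_image_eq[OF lin_d]) (use inj_d inj_on_subset in blast)
  define g where "g = (\<lambda>x. (x, A1 *v x))"
  have lin_g: "Vector_Spaces.linear (*s) cplane.scale g"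
    using linear_vec_plane[of "mat 1" A1] by (simp add: g_def)
  have dim_g: "cplane.p.dim (g ` M) = vec.dim M" for M
    by (rule vec_plane.dim_image_eq[OF lin_g]) (simp add: g_def inj_on_def)

  have "cplane.neg_index h.quad UNIV = matrix_neg_index A + matrix_neg_index B"
    using neg_index_direct_sum[OF A B] by (simp add: h_def)
  \<comment> \<open>On the antidiagonal both signs square away and the form becomes that of
    \<open>A + B = A3 - A1\<close>.\<close>
  moreover have "cplane.neg_index h.quad D = matrix_neg_index (A3 - A1)"
    unfolding D_def matrix_neg_index_def
  proof (rule vec_plane.neg_index_image[OF lin_d inj_d vec.subspace_UNIV])
    fix x :: "complex^'n"
    show "h.quad (d x) = Re (cinner x ((A3 - A1) *v x))"
      by (simp add: h_def d_def A_def B_def matrix_vector_mult_diff_rdistrib cinner_diff_right vec.neg)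
  qed
  moreover have "cplane.neg_index h.quad (h.perp D)
    = cpair.neg_index triple_quad (triple_space (graph_plane A1) (graph_plane A2) (graph_plane A3))"
  proof -
    define f where "f = (\<lambda>(u, v). ((u, A1 *v u), (v, A3 *v v)))"
    have "Vector_Spaces.linear cplane.scale cpair.scale f"
      by unfold_locales
        (auto simp: f_def cplane.scale_def cpair.scale_def matrix_vector_right_distrib vec.scale)
    moreover have "inj_on f (h.perp D)" by (auto simp: f_def inj_on_def)
    ultimately have "cpair.neg_index triple_quad (f ` h.perp D) = cplane.neg_index h.quad (h.perp D)"
    proof (rule plane_pair.neg_index_image[OF _ _ h.subspace_perp])
      fix z assume "z \<in> h.perp D"
      then obtain u v where z: "z = (u, v)" "A *v u = B *v v" by (auto simp: perp_D)
      have "symp_form (u, A1 *v u) (v, A3 *v v) = cinner u (A *v v) + cinner u (B *v v)"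
        by (simp add: symp_form_Pair A_def B_def matrix_vector_mult_diff_rdistrib cinner_diff_right
            cinner_hermitian[OF h1])
      \<comment> \<open>By self-adjointness this is
        \<open>cinner (A *v u) v = cinner (B *v v) v\<close>. The remaining conjugation disappears
        in the real part.\<close>
      also have "cinner u (A *v v) = cnj (cinner v (B *v v))"
        using z(2) cinner_hermitian[OF A] cinner_commute by metis
      also have "cinner u (B *v v) = cinner u (A *v u)" using z(2) by simp
      finally show "triple_quad (f z) = h.quad z"
        by (simp add: z(1) triple_quad_def f_def h_def)
    qed
    moreover have "f ` h.perp D = triple_space (graph_plane A1) (graph_plane A2) (graph_plane A3)"
    proof -
      have "A *v u = B *v v \<longleftrightarrow> A1 *v u + A3 *v v = A2 *v (u + v)" for u v
        unfolding A_def B_def matrix_vector_mult_diff_rdistrib matrix_vector_right_distrib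
        by (auto simp: algebra_simps)
      then show ?thesis
        unfolding perp_D f_def triple_space_def by (auto simp: image_iff)
    qed
    ultimately show ?thesis by simp
  qed
  \<comment> \<open>Both sides are the nullity of \<open>A3 - A1\<close>; in the next claim both are
    the dimension of the common kernel of \<open>A\<close> and \<open>B\<close>.\<close>
  moreover have "cplane.p.dim (D \<inter> h.perp D) = cplane.p.dim (graph_plane A1 \<inter> graph_plane A3)"
  proof -
    let ?K = "{x. A1 *v x = A3 *v x}"
    have "A *v x = B *v (- x) \<longleftrightarrow> A1 *v x = A3 *v x" for x
      unfolding A_def B_def matrix_vector_mult_diff_rdistrib
      by (auto simp: algebra_simps vec.neg)
    then have "D \<inter> h.perp D = d ` ?K" unfolding perp_D by (auto simp: D_def d_def)
    moreover have "graph_plane A1 \<inter> graph_plane A3 = g ` ?K" by (auto simp: g_def graph_plane_eq)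
    ultimately show ?thesis by (simp add: dim_d dim_g)
  qed
  moreover have "cplane.p.dim (D \<inter> h.perp UNIV)
    = cplane.p.dim (graph_plane A1 \<inter> graph_plane A2 \<inter> graph_plane A3)"
  proof -
    let ?K = "{x. A1 *v x = A2 *v x \<and> A2 *v x = A3 *v x}"
    have "A *v x = 0 \<and> B *v (- x) = 0 \<longleftrightarrow> A1 *v x = A2 *v x \<and> A2 *v x = A3 *v x" for x
      unfolding A_def B_def matrix_vector_mult_diff_rdistrib
      by (auto simp: algebra_simps vec.neg)
    then have "D \<inter> h.perp UNIV = d ` ?K" unfolding perp_UNIV by (auto simp: D_def d_def)
    moreover have "graph_plane A1 \<inter> graph_plane A2 \<inter> graph_plane A3 = g ` ?K"
      by (auto simp: g_def graph_plane_eq)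
    ultimately show ?thesis by (simp add: dim_d dim_g)
  qed
  ultimately show ?thesis
    using h.neg_index_perp[OF subD]
      duistermaat_index_add_dim[of "graph_plane A1" "graph_plane A2" "graph_plane A3"]
    unfolding A_def B_def by linarith
qed

text \<open>The triple space consists of the pairs \<open>((u, 0), (0, A *v u))\<close>, on which
  the form is that of \<open>A\<close>, and both intersections are trivial. A direct computation is
  made because \<open>infinity_plane\<close> is not a graph.\<close>

lemma duistermaat_index_normalized:
  fixes A :: "complex^'n::finite^'n"
  assumes A: "hermitian A"
  shows "duistermaat_index (graph_plane 0) (graph_plane A) infinity_plane = morse_index A"
proof -
  define f where "f = (\<lambda>u. ((u, 0 :: complex^'n), (0 :: complex^'n, A *v u)))"
  have "Vector_Spaces.linear (*s) cpair.scale f"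
    by unfold_locales
      (auto simp: f_def cplane.scale_def cpair.scale_def matrix_vector_right_distrib vec.scale)
  moreover have "inj f" by (auto simp: f_def inj_on_def)
  ultimately have "cpair.neg_index triple_quad (range f) = matrix_neg_index A"
    unfolding matrix_neg_index_def
    by (rule vec_pair.neg_index_image[OF _ _ vec.subspace_UNIV])
      (simp add: triple_quad_def f_def symp_form_Pair)
  moreover have "range f = triple_space (graph_plane 0) (graph_plane A) infinity_plane"
    by (auto simp: f_def triple_space_def infinity_plane_def image_iff)
  moreover have "graph_plane 0 \<inter> infinity_plane = {0 :: 'n cplane}"
    by (auto simp: infinity_plane_def zero_prod_def)
  moreover have "graph_plane 0 \<inter> graph_plane A \<inter> infinity_plane = {0 :: 'n cplane}"
    by (auto simp: infinity_plane_def zero_prod_def)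
  ultimately show ?thesis
    unfolding duistermaat_index_def by (simp add: matrix_neg_index_eq_morse_index[OF A])
qed

section \<open>Lagrangian planes in general position\<close>

lemma Lagrangian_subspace: "L \<in> Lagrangian \<Longrightarrow> cplane.p.subspace L"
  by (simp add: Lagrangian_def)

lemma Lagrangian_isotropic: "L \<in> Lagrangian \<Longrightarrow> u \<in> L \<Longrightarrow> v \<in> L \<Longrightarrow> symp_form u v = 0"
  by (auto simp: Lagrangian_def symp_complement_def)

lemma Lagrangian_maximal: "L \<in> Lagrangian \<Longrightarrow> (\<And>u. u \<in> L \<Longrightarrow> symp_form u v = 0) \<Longrightarrow> v \<in> L"
  by (auto simp: Lagrangian_def symp_complement_def)

lemma LagrangianI:
  assumes "cplane.p.subspace L" "\<And>u v. u \<in> L \<Longrightarrow> v \<in> L \<Longrightarrow> symp_form u v = 0"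
    "\<And>v. (\<And>u. u \<in> L \<Longrightarrow> symp_form u v = 0) \<Longrightarrow> v \<in> L"
  shows "L \<in> Lagrangian"
  using assms by (auto simp: Lagrangian_def symp_complement_def)

lemma hermitian_0: "hermitian 0"
  by (simp add: hermitian_def)

lemma graph_plane_Lagrangian:
  assumes A: "hermitian A"
  shows "graph_plane A \<in> Lagrangian"
proof (rule LagrangianI)
  show "cplane.p.subspace (graph_plane A)"
    by (rule cplane.p.subspaceI)
      (auto simp: zero_prod_def matrix_vector_right_distrib cplane.scale_def vec.scale)
  show "symp_form u v = 0" if "u \<in> graph_plane A" "v \<in> graph_plane A" for u v
    using that by (auto simp: graph_plane_eq symp_form_Pair cinner_hermitian[OF A])
  fix v assume *: "\<And>u. u \<in> graph_plane A \<Longrightarrow> symp_form u v = 0"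
  obtain x y where v: "v = (x, y)" by force
  have "cinner z y = cinner z (A *v x)" for z
    using *[of "(z, A *v z)"] by (simp add: v symp_form_Pair cinner_hermitian[OF A])
  then have "y = A *v x" by (rule cinner_ext)
  then show "v \<in> graph_plane A" by (simp add: v)
qed

lemma infinity_plane_Lagrangian: "infinity_plane \<in> Lagrangian"
proof (rule LagrangianI)
  show "cplane.p.subspace infinity_plane"
    unfolding infinity_plane_def
    by (rule cplane.subspace_Times[OF vec.subspace_single_0 vec.subspace_UNIV])
  show "symp_form u v = 0" if "u \<in> infinity_plane" "v \<in> infinity_plane" for u v :: "'a cplane"
    using that by (auto simp: infinity_plane_def symp_form_Pair)
  fix v :: "'a cplane" assume *: "\<And>u. u \<in> infinity_plane \<Longrightarrow> symp_form u v = 0"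
  obtain x y where v: "v = (x, y)" by force
  have "cinner x x = 0"
    using *[of "(0, x)"] by (simp add: v symp_form_Pair infinity_plane_def)
  then show "v \<in> infinity_plane" by (simp add: v infinity_plane_def)
qed

lemma symplectic_image_Lagrangian:
  assumes S: "symplectic S" and L: "L \<in> Lagrangian"
  shows "S ` L \<in> Lagrangian"
proof (rule LagrangianI)
  have lin: "Vector_Spaces.linear cplane.scale cplane.scale S" and "bij S"
    and form: "\<And>u v. symp_form (S u) (S v) = symp_form u v"
    using S by (auto simp: symplectic_def)
  interpret S: Vector_Spaces.linear cplane.scale cplane.scale S by (rule lin)
  show "cplane.p.subspace (S ` L)" by (rule S.subspace_image[OF Lagrangian_subspace[OF L]])
  show "symp_form u v = 0" if "u \<in> S ` L" "v \<in> S ` L" for u v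
    using that Lagrangian_isotropic[OF L] by (auto simp: form)
  fix v assume *: "\<And>u. u \<in> S ` L \<Longrightarrow> symp_form u v = 0"
  obtain w where w: "v = S w" using \<open>bij S\<close> by (metis bij_pointE)
  have "w \<in> L" by (rule Lagrangian_maximal[OF L]) (metis * form w imageI)
  then show "v \<in> S ` L" by (simp add: w)
qed

text \<open>If \<open>z\<close> is orthogonal to the projection of \<open>L\<close> to the first
  factor, then \<open>(0, z)\<close> lies in the symplectic complement, which is \<open>L\<close>,
  so \<open>z = 0\<close> and the projection is onto. Transversality makes it injective, and
  isotropy makes the resulting linear map self-adjoint.\<close>

lemma transversal_to_infinity_imp_graph:
  fixes L :: "'n::finite cplane set"
  assumes L: "L \<in> Lagrangian" and transversal: "\<And>y. (0, y) \<in> L \<Longrightarrow> y = 0"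
  obtains A where "hermitian A" "L = graph_plane A"
proof -
  have sub: "cplane.p.subspace L" by (rule Lagrangian_subspace[OF L])
  define U where "U = fst ` L"
  interpret fst: Vector_Spaces.linear cplane.scale "(*s)" "fst :: 'n cplane \<Rightarrow> complex^'n"
    by (rule cplane.linear_fst)
  have subU: "vec.subspace U"
    unfolding U_def by (rule fst.subspace_image[OF sub])
  have "cinner.perp U \<subseteq> {0}"
  proof
    fix z assume z: "z \<in> cinner.perp U"
    have "(0, z) \<in> L"
    proof (rule Lagrangian_maximal[OF L])
      fix u assume "u \<in> L"
      then show "symp_form u (0, z) = 0"
        using z by (auto simp: symp_form_def cinner.perp_def U_def)
    qed
    then show "z \<in> {0}" using transversal by simp
  qed
  then have "vec.dim (cinner.perp U) = 0" by (simp only: vec.dim_eq_0)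
  moreover have "vec.dim (UNIV :: (complex^'n) set) \<le> vec.dim (cinner.perp U) + vec.dim U"
    using cinner.dim_perp_ge[OF vec.subspace_UNIV subU vec.subspace_single_0] vec.subspace_0[OF subU]
    by (simp add: cinner.perp_def)
  ultimately have "vec.dim (UNIV :: (complex^'n) set) \<le> vec.dim U" by linarith
  then have "U = UNIV"
    by (intro vec.subspace_dim_equal[OF subU vec.subspace_UNIV] subset_UNIV)
  then have "\<forall>x. \<exists>y. (x, y) \<in> L" unfolding U_def by (metis UNIV_I imageE prod.collapse)
  then obtain g where g: "\<And>x. (x, g x) \<in> L" by metis
  have unique: "y = g x" if "(x, y) \<in> L" for x y
    using cplane.p.subspace_diff[OF sub that g[of x]] transversal[of "y - g x"] by simp
  have lin: "Vector_Spaces.linear (*s) (*s) g"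
  proof unfold_locales
    show "g (x + y) = g x + g y" for x y
      using unique[of "x + y" "g x + g y"] cplane.p.subspace_add[OF sub g g, of x y] by simp
    show "g (c *s x) = c *s g x" for c x
      using unique[of "c *s x" "c *s g x"] cplane.p.subspace_scale[OF sub g, of c x]
      by (simp add: cplane.scale_prod)
  qed
  define A where "A = matrix g"
  have A: "A *v x = g x" for x unfolding A_def by (rule matrix_works[OF lin])
  have "hermitian A"
    unfolding hermitian_iff_self_adjoint
    using Lagrangian_isotropic[OF L g g] by (simp add: A symp_form_Pair)
  moreover have "L = graph_plane A"
    using g unique by (auto simp: graph_plane_def A)
  ultimately show thesis by (rule that)
qed

section \<open>Symplectic maps that move planes to graphs\<close>

text \<open>The inversion that sends \<open>graph_plane (mat t)\<close> to \<open>infinity_plane\<close>.\<close>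

definition invert_at :: "real \<Rightarrow> 'n::finite cplane \<Rightarrow> 'n cplane" where
  "invert_at t = (\<lambda>(x, y). (y - complex_of_real t *s x, - x))"

text \<open>Translates every graph by \<open>- A\<close> and fixes \<open>infinity_plane\<close>,
  which brings a pair of graphs into the position of the normalization property.\<close>

definition shear :: "complex^'n^'n \<Rightarrow> 'n::finite cplane \<Rightarrow> 'n cplane" where
  "shear A = (\<lambda>(x, y). (x, y - A *v x))"

lemma symplectic_invert_at: "symplectic (invert_at t)"
  unfolding symplectic_def
proof (intro conjI allI)
  show "Vector_Spaces.linear cplane.scale cplane.scale (invert_at t)"
    by unfold_locales (auto simp: invert_at_def cplane.scale_def algebra_simps vec.scale_right_distrib vec.scale_right_diff_distrib)
  show "bij (invert_at t)"
    by (rule bij_betw_byWitness[where f' = "\<lambda>(x, y). (- y, x - complex_of_real t *s y)"])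
      (auto simp: invert_at_def)
  show "symp_form (invert_at t u) (invert_at t v) = symp_form u v" for u v :: "'a cplane"
    by (cases u; cases v)
      (simp add: invert_at_def symp_form_Pair cinner_diff_left cinner_diff_right cinner_scale_right
        cinner.scale_left)
qed

lemma symplectic_shear:
  assumes A: "hermitian A"
  shows "symplectic (shear A)"
  unfolding symplectic_def
proof (intro conjI allI)
  show "Vector_Spaces.linear cplane.scale cplane.scale (shear A)"
    by unfold_locales (auto simp: shear_def cplane.scale_def algebra_simps vec.scale vec.scale_right_diff_distrib
        matrix_vector_right_distrib)
  show "bij (shear A)"
    by (rule bij_betw_byWitness[where f' = "\<lambda>(x, y). (x, y + A *v x)"])
      (auto simp: shear_def)
  show "symp_form (shear A u) (shear A v) = symp_form u v" for u v
    by (cases u; cases v)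
      (simp add: shear_def symp_form_Pair cinner_diff_left cinner_diff_right cinner_hermitian[OF A])
qed

lemma shear_graph_plane: "shear A ` graph_plane B = graph_plane (B - A)"
  by (auto simp: shear_def graph_plane_eq matrix_vector_mult_diff_rdistrib image_image)

lemma shear_infinity_plane: "shear A ` infinity_plane = infinity_plane"
  by (auto simp: shear_def infinity_plane_def image_iff)

lemma finite_nontransversal:
  assumes L: "L \<in> Lagrangian"
  shows "finite {t. \<exists>x. x \<noteq> 0 \<and> (x, complex_of_real t *s x) \<in> L}" (is "finite ?T")
proof -
  obtain f where f: "\<And>t. t \<in> ?T \<Longrightarrow> f t \<noteq> 0 \<and> (f t, complex_of_real t *s f t) \<in> L"
    using bchoice[of ?T "\<lambda>t x. x \<noteq> 0 \<and> (x, complex_of_real t *s x) \<in> L"] by blast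
  show ?thesis
  proof (rule finite_orthogonal_family[of ?T f])
    fix s t assume st: "s \<in> ?T" "t \<in> ?T" "s \<noteq> t"
    have "symp_form (f s, complex_of_real s *s f s) (f t, complex_of_real t *s f t) = 0"
      using Lagrangian_isotropic[OF L] f st by blast
    \<comment> \<open>As \<open>s\<close> is real, conjugate-linearity in the first argument leaves
      it unchanged.\<close>
    then have "(complex_of_real t - complex_of_real s) * cinner (f s) (f t) = 0"
      by (simp add: symp_form_Pair cinner_scale_right cinner.scale_left algebra_simps)
    then show "cinner (f s) (f t) = 0" using st(3) by simp
  qed (use f in blast)
qed

lemma exists_symplectic_to_graphs:
  fixes \<L> :: "'n::finite cplane set set"
  assumes "finite \<L>" and \<L>: "\<L> \<subseteq> Lagrangian"
  obtains S where "symplectic S" "\<And>L. L \<in> \<L> \<Longrightarrow> \<exists>A. hermitian A \<and> S ` L = graph_plane A"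
proof -
  have "finite (\<Union>L\<in>\<L>. {t. \<exists>x. x \<noteq> 0 \<and> (x, complex_of_real t *s x) \<in> L})"
    using assms finite_nontransversal by (intro finite_UN_I) auto
  then obtain t where t: "t \<notin> (\<Union>L\<in>\<L>. {t. \<exists>x. x \<noteq> 0 \<and> (x, complex_of_real t *s x) \<in> L})"
    using ex_new_if_finite[OF infinite_UNIV_char_0] by blast
  show thesis
  proof (rule that[OF symplectic_invert_at[of t]])
    fix L assume "L \<in> \<L>"
    have "invert_at t ` L \<in> Lagrangian"
      using \<open>L \<in> \<L>\<close> \<L> symplectic_image_Lagrangian symplectic_invert_at by blast
    moreover have "y = 0" if y: "(0, y) \<in> invert_at t ` L" for y
    proof -
      \<comment> \<open>A vector of the image in \<open>infinity_plane\<close> comes from a point of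
        \<open>L\<close> on the graph of the scalar \<open>t\<close>, and \<open>t\<close> was
        chosen so that only 0 is such a point.\<close>
      obtain x z where "(x, z) \<in> L" "z = complex_of_real t *s x" "y = - x"
        using y by (auto simp: invert_at_def)
      then show ?thesis using t \<open>L \<in> \<L>\<close> by auto
    qed
    ultimately obtain A where "hermitian A" "invert_at t ` L = graph_plane A"
      by (rule transversal_to_infinity_imp_graph)
    then show "\<exists>A. hermitian A \<and> invert_at t ` L = graph_plane A" by blast
  qed
qed

section \<open>Range and cocycle property\<close>

lemma duistermaat_index_le:
  fixes L1 L2 L3 :: "'n::finite cplane set"
  assumes "L1 \<in> Lagrangian" "L2 \<in> Lagrangian" "L3 \<in> Lagrangian"
  shows "duistermaat_index L1 L2 L3 \<le> CARD('n)"
proof -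
  obtain S where S: "symplectic S"
    and graph: "\<And>L. L \<in> {L1, L2, L3} \<Longrightarrow> \<exists>A. hermitian A \<and> S ` L = graph_plane A"
    by (rule exists_symplectic_to_graphs[of "{L1, L2, L3}"]) (use assms in auto)
  obtain A1 A2 A3 where A: "hermitian A1" "hermitian A2" "hermitian A3"
    and eq: "S ` L1 = graph_plane A1" "S ` L2 = graph_plane A2" "S ` L3 = graph_plane A3"
    using graph by (metis insertI1 insertI2)
  have "duistermaat_index L1 L2 L3 + matrix_neg_index (A3 - A1)
      = matrix_neg_index (A2 - A1) + matrix_neg_index (A3 - A2)"
    using duistermaat_index_graphs[OF A] duistermaat_index_symplectic[OF S assms[THEN Lagrangian_subspace]]
    by (simp add: eq)
  moreover have "(A2 - A1) + (A3 - A2) = A3 - A1" by simp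
  ultimately show ?thesis using matrix_neg_index_add_le[of "A2 - A1" "A3 - A2"] by simp
qed

text \<open>One symplectic map turns all four planes into graphs. There the index is a coboundary of
  the numbers n_-(Aj - Ai), and the alternating sum cancels.\<close>

lemma duistermaat_index_cocycle:
  fixes L1 L2 L3 L4 :: "'n::finite cplane set"
  assumes "L1 \<in> Lagrangian" "L2 \<in> Lagrangian" "L3 \<in> Lagrangian" "L4 \<in> Lagrangian"
  shows "duistermaat_index L1 L2 L3 + duistermaat_index L1 L3 L4
    = duistermaat_index L1 L2 L4 + duistermaat_index L2 L3 L4"
proof -
  obtain S where S: "symplectic S"
    and graph: "\<And>L. L \<in> {L1, L2, L3, L4} \<Longrightarrow> \<exists>A. hermitian A \<and> S ` L = graph_plane A"
    by (rule exists_symplectic_to_graphs[of "{L1, L2, L3, L4}"]) (use assms in auto)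
  obtain A1 A2 A3 A4 where A: "hermitian A1" "hermitian A2" "hermitian A3" "hermitian A4"
    and eq: "S ` L1 = graph_plane A1" "S ` L2 = graph_plane A2" "S ` L3 = graph_plane A3"
      "S ` L4 = graph_plane A4"
    using graph by (metis insertI1 insertI2)
  have sub: "cplane.p.subspace L1" "cplane.p.subspace L2" "cplane.p.subspace L3" "cplane.p.subspace L4"
    using assms Lagrangian_subspace by auto
  note inv = duistermaat_index_symplectic[OF S]
  show ?thesis
    using duistermaat_index_graphs[OF A(1,2,3)] duistermaat_index_graphs[OF A(1,3,4)]
      duistermaat_index_graphs[OF A(1,2,4)] duistermaat_index_graphs[OF A(2,3,4)]
      inv[OF sub(1,2,3)] inv[OF sub(1,3,4)] inv[OF sub(1,2,4)] inv[OF sub(2,3,4)]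
    unfolding eq by linarith
qed

section \<open>Uniqueness\<close>

lemma index_eq_duistermaat_index:
  fixes \<iota> :: "'n::finite cplane set \<times> 'n cplane set \<times> 'n cplane set \<Rightarrow> nat"
  assumes norm: "\<And>A. hermitian A \<Longrightarrow> \<iota> (graph_plane 0, graph_plane A, infinity_plane) = morse_index A"
    and inv: "\<And>S L1 L2 L3. symplectic S \<Longrightarrow> L1 \<in> Lagrangian \<Longrightarrow> L2 \<in> Lagrangian \<Longrightarrow> L3 \<in> Lagrangian
      \<Longrightarrow> \<iota> (S ` L1, S ` L2, S ` L3) = \<iota> (L1, L2, L3)"
    and cocycle: "\<And>L1 L2 L3 L4. L1 \<in> Lagrangian \<Longrightarrow> L2 \<in> Lagrangian \<Longrightarrow> L3 \<in> Lagrangian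
      \<Longrightarrow> L4 \<in> Lagrangian \<Longrightarrow> int (\<iota> (L1, L2, L3)) - int (\<iota> (L1, L2, L4)) + int (\<iota> (L1, L3, L4))
         - int (\<iota> (L2, L3, L4)) = 0"
    and L: "L1 \<in> Lagrangian" "L2 \<in> Lagrangian" "L3 \<in> Lagrangian"
  shows "\<iota> (L1, L2, L3) = duistermaat_index L1 L2 L3"
proof -
  \<comment> \<open>Shearing by \<open>A\<close> reduces this to the triple
    \<open>graph_plane 0\<close>, \<open>graph_plane (B - A)\<close>,
    \<open>infinity_plane\<close>.\<close>
  have infinity: "\<iota> (graph_plane A, graph_plane B, infinity_plane) = matrix_neg_index (B - A)"
    if "hermitian A" "hermitian B" for A B
  proof -
    have "\<iota> (shear A ` graph_plane A, shear A ` graph_plane B, shear A ` infinity_plane)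
        = \<iota> (graph_plane A, graph_plane B, infinity_plane)"
      by (intro inv symplectic_shear graph_plane_Lagrangian infinity_plane_Lagrangian that)
    then show ?thesis
      unfolding shear_graph_plane shear_infinity_plane
      using norm[of "B - A"] hermitian_diff[OF that(2,1)]
      by (simp add: matrix_neg_index_eq_morse_index)
  qed
  obtain S where S: "symplectic S"
    and graph: "\<And>L. L \<in> {L1, L2, L3} \<Longrightarrow> \<exists>A. hermitian A \<and> S ` L = graph_plane A"
    by (rule exists_symplectic_to_graphs[of "{L1, L2, L3}"]) (use L in auto)
  obtain A1 A2 A3 where A: "hermitian A1" "hermitian A2" "hermitian A3"
    and eq: "S ` L1 = graph_plane A1" "S ` L2 = graph_plane A2" "S ` L3 = graph_plane A3"
    using graph by (metis insertI1 insertI2)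
  \<comment> \<open>With \<open>infinity_plane\<close> as fourth plane, three of the four terms of
    the cocycle identity are already known.\<close>
  have "int (\<iota> (graph_plane A1, graph_plane A2, graph_plane A3)) - int (matrix_neg_index (A2 - A1))
      + int (matrix_neg_index (A3 - A1)) - int (matrix_neg_index (A3 - A2)) = 0"
    using cocycle[of "graph_plane A1" "graph_plane A2" "graph_plane A3" infinity_plane]
    by (simp add: A graph_plane_Lagrangian infinity_plane_Lagrangian infinity)
  moreover have "\<iota> (graph_plane A1, graph_plane A2, graph_plane A3) = \<iota> (L1, L2, L3)"
    using inv[OF S L] by (simp add: eq)
  moreover have "duistermaat_index (graph_plane A1) (graph_plane A2) (graph_plane A3)
      = duistermaat_index L1 L2 L3"
    using duistermaat_index_symplectic[OF S L[THEN Lagrangian_subspace]] by (simp add: eq)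
  ultimately show ?thesis using duistermaat_index_graphs[OF A] by linarith
qed

text \<open>Types are nonempty, so \<open>CARD('n)\<close> is at least 1. The extensional function
  space makes uniqueness an equality of functions, and the casts to \<open>int\<close> keep the
  differences from truncating.\<close>

theorem theorem1p1:
  shows "\<exists>!\<iota> :: 'n::finite cplane set \<times> 'n cplane set \<times> 'n cplane set \<Rightarrow> nat.
    \<iota> \<in> Lagrangian \<times> Lagrangian \<times> Lagrangian \<rightarrow>\<^sub>E {0..CARD('n)} \<and>
    (\<forall>A. hermitian A \<longrightarrow> \<iota> (graph_plane 0, graph_plane A, infinity_plane) = morse_index A) \<and>
    (\<forall>S. symplectic S \<longrightarrow>
       (\<forall>L1\<in>Lagrangian. \<forall>L2\<in>Lagrangian. \<forall>L3\<in>Lagrangian.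
          \<iota> (S ` L1, S ` L2, S ` L3) = \<iota> (L1, L2, L3))) \<and>
    (\<forall>L1\<in>Lagrangian. \<forall>L2\<in>Lagrangian. \<forall>L3\<in>Lagrangian. \<forall>L4\<in>Lagrangian.
       int (\<iota> (L1, L2, L3)) - int (\<iota> (L1, L2, L4)) + int (\<iota> (L1, L3, L4))
         - int (\<iota> (L2, L3, L4)) = 0)"
  (is "\<exists>!\<iota>. ?P \<iota>")
proof
  let ?T = "Lagrangian \<times> Lagrangian \<times> Lagrangian :: ('n cplane set \<times> 'n cplane set \<times> 'n cplane set) set"
  \<comment> \<open>The restriction supplies the value \<open>undefined\<close> outside Lagrangian
    triples, as the extensional function space requires.\<close>
  define \<iota>0 :: "'n cplane set \<times> 'n cplane set \<times> 'n cplane set \<Rightarrow> nat"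
    where "\<iota>0 = restrict (\<lambda>(L1, L2, L3). duistermaat_index L1 L2 L3) ?T"
  have \<iota>0: "\<iota>0 (L1, L2, L3) = duistermaat_index L1 L2 L3"
    if "L1 \<in> Lagrangian" "L2 \<in> Lagrangian" "L3 \<in> Lagrangian" for L1 L2 L3
    using that by (simp add: \<iota>0_def)
  show "?P \<iota>0"
  proof (intro conjI allI impI ballI)
    show "\<iota>0 \<in> ?T \<rightarrow>\<^sub>E {0..CARD('n)}"
      unfolding \<iota>0_def by (auto simp: duistermaat_index_le)
    show "\<iota>0 (graph_plane 0, graph_plane A, infinity_plane) = morse_index A" if "hermitian A" for A
      using that by (simp add: \<iota>0 graph_plane_Lagrangian hermitian_0 infinity_plane_Lagrangian
          duistermaat_index_normalized)
    show "\<iota>0 (S ` L1, S ` L2, S ` L3) = \<iota>0 (L1, L2, L3)"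
      if "symplectic S" "L1 \<in> Lagrangian" "L2 \<in> Lagrangian" "L3 \<in> Lagrangian" for S L1 L2 L3
      using that by (simp add: \<iota>0 symplectic_image_Lagrangian duistermaat_index_symplectic
          Lagrangian_subspace)
    show "int (\<iota>0 (L1, L2, L3)) - int (\<iota>0 (L1, L2, L4)) + int (\<iota>0 (L1, L3, L4))
        - int (\<iota>0 (L2, L3, L4)) = 0"
      if "L1 \<in> Lagrangian" "L2 \<in> Lagrangian" "L3 \<in> Lagrangian" "L4 \<in> Lagrangian" for L1 L2 L3 L4
      using duistermaat_index_cocycle[OF that] that by (simp add: \<iota>0)
  qed
  fix \<iota> assume \<iota>: "?P \<iota>"
  show "\<iota> = \<iota>0"
  proof (rule PiE_ext[where k = ?T and s = "\<lambda>_. {0..CARD('n)}"])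
    show "\<iota> \<in> ?T \<rightarrow>\<^sub>E {0..CARD('n)}" using \<iota> by blast
    show "\<iota>0 \<in> ?T \<rightarrow>\<^sub>E {0..CARD('n)}" using \<open>?P \<iota>0\<close> by blast
    fix X assume "X \<in> ?T"
    then obtain L1 L2 L3 where X: "X = (L1, L2, L3)"
      "L1 \<in> Lagrangian" "L2 \<in> Lagrangian" "L3 \<in> Lagrangian" by auto
    have "\<iota> (L1, L2, L3) = duistermaat_index L1 L2 L3"
      by (rule index_eq_duistermaat_index[OF _ _ _ X(2,3,4)]) (use \<iota> in blast)+
    then show "\<iota> X = \<iota>0 X" using X by (simp add: \<iota>0)
  qed
qed

end
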